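(* The set $$\mathcal{M}_h=\{(X,G)\in\mathbb{R}^{m\times n}\times\mathrm{Gr}(n,n-r):\ XG=0,\ h(X)=0\}$$ is an embedded submanifold in $\mathbb{R}^{m\times n}\times\mathrm{Gr}(n,n-r)$ of dimension $(m+n-r)r-q$.
   Context: Let $r\le\min\{m,n\}$. The map $h:\mathbb{R}^{m\times n}\to\mathbb{R}^q$ is smooth and orthogonally invariant, i.e. $h(XQ)=h(X)$ for all $X$ and all $Q\in\mathcal{O}(n)=\{Q\in\mathbb{R}^{n\times n}:Q^\top Q=I_n\}$. Put $\mathcal{H}=\{X\in\mathbb{R}^{m\times n}:h(X)=0\}$; it is assumed that the differential $\mathrm{D}h_X$ has rank $q$ for all $X\in\mathcal{H}$. $\mathrm{Sym}(n)$ is the space of symmetric $n\times n$ real matrices. The Grassmann manifold is $\mathrm{Gr}(n,s)=\{G\in\mathrm{Sym}(n):G^2=G,\ \operatorname{rank}(G)=s\}$, an embedded submanifold of $\mathrm{Sym}(n)$. *)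

theory Defs
  imports "HOL-Analysis.Analysis"
begin

(* C^n on an open set S, by iterated directional derivatives; on a finite-dimensional domain
   this agrees with the usual notion. Only meaningful for open S. *)
primrec higher_differentiable_on ::
  "'a::real_normed_vector set \<Rightarrow> ('a \<Rightarrow> 'b::real_normed_vector) \<Rightarrow> nat \<Rightarrow> bool" where
  "higher_differentiable_on S f 0 \<longleftrightarrow> continuous_on S f"
| "higher_differentiable_on S f (Suc n) \<longleftrightarrow>
     (\<forall>x\<in>S. f differentiable (at x)) \<and>
     (\<forall>v. higher_differentiable_on S (\<lambda>x. frechet_derivative f (at x) v) n)"

(* Smoothness on an arbitrary subset A of a Euclidean space: local existence of
   C-infinity extensions to open sets of the ambient space. *)
definition smooth_map_on ::
  "'a::euclidean_space set \<Rightarrow> ('a \<Rightarrow> 'b::euclidean_space) \<Rightarrow> bool" where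
  "smooth_map_on A f \<longleftrightarrow>
     (\<forall>x\<in>A. \<exists>U g. open U \<and> x \<in> U \<and> (\<forall>n. higher_differentiable_on U g n) \<and>
       (\<forall>y\<in>A \<inter> U. f y = g y))"

definition diffeomorphism_between ::
  "'a::euclidean_space set \<Rightarrow> 'b::euclidean_space set \<Rightarrow> ('a \<Rightarrow> 'b) \<Rightarrow> ('b \<Rightarrow> 'a) \<Rightarrow> bool" where
  "diffeomorphism_between A B f g \<longleftrightarrow>
     smooth_map_on A f \<and> smooth_map_on B g \<and> f ` A = B \<and> g ` B = A \<and>
     (\<forall>x\<in>A. g (f x) = x) \<and> (\<forall>y\<in>B. f (g y) = y)"

(* (U, phi) is a smooth chart of the subset N of a Euclidean space, with inverse psi.
   A linear subspace L of the same space plays the role of R^k, k = dim L; this avoids a type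
   of dimension k and loses nothing, as the dimension of N cannot exceed that of the space. *)
definition local_chart ::
  "'a::euclidean_space set \<Rightarrow> 'a set \<Rightarrow> 'a set \<Rightarrow> 'a set \<Rightarrow> ('a \<Rightarrow> 'a) \<Rightarrow> ('a \<Rightarrow> 'a) \<Rightarrow> bool" where
  "local_chart N L U V \<phi> \<psi> \<longleftrightarrow>
     subspace L \<and> openin (top_of_set N) U \<and> openin (top_of_set L) V \<and>
     diffeomorphism_between U V \<phi> \<psi>"

(* N is a k-dimensional smooth (equivalently, embedded) submanifold of its Euclidean space. *)
definition smooth_manifold :: "'a::euclidean_space set \<Rightarrow> nat \<Rightarrow> bool" where
  "smooth_manifold N k \<longleftrightarrow>
     (\<forall>p\<in>N. \<exists>L U V \<phi> \<psi>. dim L = k \<and> p \<in> U \<and> local_chart N L U V \<phi> \<psi>)"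

(* S is a d-dimensional embedded submanifold of the manifold N: around each point of S there
   is a chart of N in which S becomes a d-dimensional linear slice. The dimension is an
   integer so that formulas for it involve no truncated subtraction. As usual, the empty set
   is an embedded submanifold of every dimension. *)
definition embedded_submanifold_in :: "'a::euclidean_space set \<Rightarrow> 'a set \<Rightarrow> int \<Rightarrow> bool" where
  "embedded_submanifold_in N S d \<longleftrightarrow>
     S \<subseteq> N \<and>
     (\<exists>k. smooth_manifold N k \<and>
       (\<forall>p\<in>S. \<exists>L K U V \<phi> \<psi>. dim L = k \<and> p \<in> U \<and> local_chart N L U V \<phi> \<psi> \<and>
          subspace K \<and> K \<subseteq> L \<and> int (dim K) = d \<and> \<phi> ` (S \<inter> U) = V \<inter> K))"

(* An m x n matrix has type real^'n^'m, with m = CARD('m), n = CARD('n). *)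

definition Gr :: "nat \<Rightarrow> (real^'n^'n) set" where
  "Gr s = {G. transpose G = G \<and> G ** G = G \<and> rank G = s}"

definition orthogonally_invariant :: "(real^'n^'m \<Rightarrow> 'b) \<Rightarrow> bool" where
  "orthogonally_invariant h \<longleftrightarrow> (\<forall>X Q. orthogonal_matrix Q \<longrightarrow> h (X ** Q) = h X)"

definition M_set ::
  "(real^'n^'m \<Rightarrow> real^'q) \<Rightarrow> nat \<Rightarrow> ((real^'n^'m) \<times> (real^'n^'n)) set" where
  "M_set h r = {(X, G). G \<in> Gr (CARD('n) - r) \<and> X ** G = 0 \<and> h X = 0}"

end

theory Submission
  imports Defs
begin

text \<open>
  Write \<open>n\<close>, \<open>m\<close>, \<open>q\<close> for the cardinalities of the index types, and fix a point \<open>(X0, G0)\<close> with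
  \<open>X0 G0 = 0\<close>, where \<open>G0\<close> is an orthogonal projector of rank \<open>n - r\<close>. The proof writes down one
  explicit smooth map \<open>\<Phi>\<close> of the whole ambient space, polynomial in \<open>X\<close>, \<open>G\<close> and \<open>h X\<close>,
  whose derivative at \<open>(X0, G0)\<close> is invertible and which carries, near that point, the manifold of all \<open>(X, G)\<close> to a linear subspace
  and the solution set to a smaller one. The inverse function theorem turns \<open>\<Phi>\<close> into a slice chart
  (\<open>flattening_imp_slice_chart\<close>).

  Three observations make such a map possible.

  The Grassmannian is flattened by a quadratic map (\<open>grassmann_flattening\<close>). In the block form
  defined by \<open>G0\<close>, keep the off-diagonal blocks of \<open>G\<close> and replace the diagonal ones by those of
  \<open>\<plusminus>(G\<^sup>2 - G)\<close>. The derivative at \<open>G0\<close> is the identity. Among symmetric \<open>G\<close> near \<open>G0\<close>, vanishing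
  of the two diagonal blocks already forces \<open>G\<^sup>2 = G\<close>, because \<open>G\<^sup>2 - G\<close> commutes with \<open>G\<close>. So \<open>Gr\<close>
  locally becomes the space of symmetric off-diagonal matrices, of dimension \<open>r (n - r)\<close>.

  The equation \<open>X G = 0\<close> is straightened by \<open>Y = X T\<close> with \<open>T = G G0 + (1 - G) (1 - G0)\<close>. For
  projectors \<open>G T = T G0\<close>, and \<open>T\<close> is invertible near \<open>G0\<close>, so \<open>X G = 0\<close> is the fixed linear
  equation \<open>Y G0 = 0\<close>.

  The equation \<open>h X = 0\<close> stays independent of \<open>X G = 0\<close> thanks to orthogonal invariance
  (\<open>orthogonally_invariant_derivative\<close>): the reflection \<open>1 - 2 G0\<close> fixes \<open>X0\<close> and negates \<open>V G0\<close>,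
  so the derivative \<open>D\<close> of \<open>h\<close> at \<open>X0\<close> kills all \<open>V G0\<close>. Hence \<open>D\<close> is already onto on
  \<open>W = {Z. Z G0 = 0}\<close> and has a linear right inverse \<open>E\<close> into \<open>W\<close>. Replacing \<open>Y\<close> by
  \<open>Z = Y - E (D Y) + E (h X)\<close> does not affect \<open>Y G0\<close> and makes \<open>h X = 0\<close> the linear equation
  \<open>E (D Z) = 0\<close>.

  The model of the solution set is the product of \<open>{Z \<in> W. D Z = 0}\<close> and the off-diagonal matrices,
  of dimension \<open>(m r - q) + r (n - r) = (m + n - r) r - q\<close>.
\<close>

section \<open>Calculus of iterated differentiability\<close>

lemma higher_differentiable_on_subset:
  "higher_differentiable_on S f n \<Longrightarrow> T \<subseteq> S \<Longrightarrow> higher_differentiable_on T f n"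
  by (induction n arbitrary: f) (auto intro: continuous_on_subset)

lemma higher_differentiable_on_cong:
  assumes "open S" "\<And>x. x \<in> S \<Longrightarrow> f x = g x" "higher_differentiable_on S f n"
  shows "higher_differentiable_on S g n"
  using assms(2,3)
proof (induction n arbitrary: f g)
  case 0
  then show ?case by (simp cong: continuous_on_cong)
next
  case (Suc n)
  have d: "f differentiable (at x)" if "x \<in> S" for x
    using Suc.prems(2) that by simp
  have g: "g differentiable (at x)" if "x \<in> S" for x
  proof -
    obtain D where "(f has_derivative D) (at x)"
      using d[OF \<open>x \<in> S\<close>] unfolding differentiable_def by blast
    then have "(g has_derivative D) (at x)"
      by (rule has_derivative_transform_within_open[OF _ \<open>open S\<close> \<open>x \<in> S\<close>]) (rule Suc.prems(1))
    then show ?thesis unfolding differentiable_def by blast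
  qed
  have e: "frechet_derivative f (at x) = frechet_derivative g (at x)" if "x \<in> S" for x
    by (rule frechet_derivative_transform_within_open[OF d[OF that] \<open>open S\<close> that Suc.prems(1)])
  have "higher_differentiable_on S (\<lambda>x. frechet_derivative g (at x) v) n" for v
    by (rule Suc.IH[of "\<lambda>x. frechet_derivative f (at x) v"]) (use e Suc.prems(2) in auto)
  with g show ?case by simp
qed

text \<open>Any explicit formula for the derivative may replace \<open>frechet_derivative\<close>; this is the form in
  which all closure properties below are proved by induction on the order.\<close>
lemma higher_differentiable_on_SucI:
  assumes "open S" "\<And>x. x \<in> S \<Longrightarrow> (f has_derivative f' x) (at x)"
    and "\<And>v. higher_differentiable_on S (\<lambda>x. f' x v) n"
  shows "higher_differentiable_on S f (Suc n)"
proof -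
  have "f' x v = frechet_derivative f (at x) v" if "x \<in> S" for x v
    using frechet_derivative_at[OF assms(2)[OF that]] by simp
  then have "higher_differentiable_on S (\<lambda>x. frechet_derivative f (at x) v) n" for v
    using higher_differentiable_on_cong[OF assms(1) _ assms(3)[of v]] by simp
  then show ?thesis using assms(2) by (auto simp: differentiable_def)
qed

lemma higher_differentiable_on_SucD:
  "higher_differentiable_on S f (Suc n) \<Longrightarrow> higher_differentiable_on S f n"
proof (induction n arbitrary: f)
  case 0
  then show ?case
    by (auto intro!: continuous_at_imp_continuous_on differentiable_imp_continuous_within)
next
  case (Suc n)
  then show ?case by (metis higher_differentiable_on.simps(2))
qed

lemma higher_differentiable_on_has_derivative:
  assumes "higher_differentiable_on S f (Suc n)" "x \<in> S"
  shows "(f has_derivative frechet_derivative f (at x)) (at x)"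
  using assms by (simp add: frechet_derivative_works)

text \<open>This glues the local extensions by which smoothness on a set is defined.\<close>
lemma higher_differentiable_on_locally:
  assumes "\<And>x. x \<in> S \<Longrightarrow> \<exists>U. open U \<and> x \<in> U \<and> higher_differentiable_on U f n"
  shows "higher_differentiable_on S f n"
  using assms
proof (induction n arbitrary: f)
  case 0
  have "isCont f x" if "x \<in> S" for x
    using 0[OF that] by (auto simp: continuous_on_eq_continuous_at)
  then show ?case by (simp add: continuous_at_imp_continuous_on)
next
  case (Suc n)
  have "f differentiable (at x)" if "x \<in> S" for x
    using Suc.prems[OF that] by auto
  moreover have "higher_differentiable_on S (\<lambda>x. frechet_derivative f (at x) v) n" for v
  proof (rule Suc.IH)
    fix x assume "x \<in> S"
    from Suc.prems[OF this] obtain U where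
      "open U" "x \<in> U" "higher_differentiable_on U f (Suc n)" by blast
    then show "\<exists>U. open U \<and> x \<in> U \<and>
        higher_differentiable_on U (\<lambda>x. frechet_derivative f (at x) v) n" by auto
  qed
  ultimately show ?case by simp
qed

lemma higher_differentiable_on_const:
  "open S \<Longrightarrow> higher_differentiable_on S (\<lambda>x. c) n"
proof (induction n arbitrary: c)
  case (Suc n)
  show ?case
    by (rule higher_differentiable_on_SucI[where f'="\<lambda>x v. 0"]) (use Suc in auto)
qed auto

lemma higher_differentiable_on_linear:
  assumes "open S" "bounded_linear L"
  shows "higher_differentiable_on S L n"
proof (cases n)
  case 0
  then show ?thesis using assms by (simp add: linear_continuous_on)
next
  case (Suc k)
  show ?thesis unfolding Suc
    by (rule higher_differentiable_on_SucI[where f'="\<lambda>x. L"])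
      (use assms in \<open>auto intro: bounded_linear_imp_has_derivative higher_differentiable_on_const\<close>)
qed

lemma higher_differentiable_on_linear_compose:
  assumes "open S" "bounded_linear L" "higher_differentiable_on S f n"
  shows "higher_differentiable_on S (\<lambda>x. L (f x)) n"
  using assms(3)
proof (induction n arbitrary: f)
  case 0
  then show ?case using assms by (auto intro: bounded_linear.continuous_on)
next
  case (Suc n)
  show ?case
    by (rule higher_differentiable_on_SucI[where f'="\<lambda>x v. L (frechet_derivative f (at x) v)"])
      (use assms Suc higher_differentiable_on_has_derivative[OF Suc.prems] in
        \<open>auto intro: bounded_linear.has_derivative\<close>)
qed

lemma higher_differentiable_on_add:
  assumes "open S" "higher_differentiable_on S f n" "higher_differentiable_on S g n"
  shows "higher_differentiable_on S (\<lambda>x. f x + g x) n"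
  using assms(2,3)
proof (induction n arbitrary: f g)
  case 0
  then show ?case by (auto intro: continuous_intros)
next
  case (Suc n)
  show ?case
    by (rule higher_differentiable_on_SucI[where f'=
          "\<lambda>x v. frechet_derivative f (at x) v + frechet_derivative g (at x) v"])
      (use assms(1) Suc higher_differentiable_on_has_derivative[OF Suc.prems(1)]
        higher_differentiable_on_has_derivative[OF Suc.prems(2)] in
        \<open>auto intro: has_derivative_add\<close>)
qed

lemma higher_differentiable_on_minus:
  assumes "open S" "higher_differentiable_on S f n"
  shows "higher_differentiable_on S (\<lambda>x. - f x) n"
  using higher_differentiable_on_linear_compose[OF assms(1) bounded_linear_minus[OF bounded_linear_ident] assms(2)] .

lemma higher_differentiable_on_diff:
  assumes "open S" "higher_differentiable_on S f n" "higher_differentiable_on S g n"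
  shows "higher_differentiable_on S (\<lambda>x. f x - g x) n"
  using higher_differentiable_on_add[OF assms(1,2) higher_differentiable_on_minus[OF assms(1,3)]]
  by simp

lemma higher_differentiable_on_sum:
  assumes "open S" "\<And>i. i \<in> I \<Longrightarrow> higher_differentiable_on S (f i) n"
  shows "higher_differentiable_on S (\<lambda>x. \<Sum>i\<in>I. f i x) n"
  using assms(2)
  by (induction I rule: infinite_finite_induct)
    (auto intro: higher_differentiable_on_const higher_differentiable_on_add assms(1))

lemma higher_differentiable_on_bilinear:
  assumes "open S" "bounded_bilinear B"
    and "higher_differentiable_on S f n" "higher_differentiable_on S g n"
  shows "higher_differentiable_on S (\<lambda>x. B (f x) (g x)) n"
  using assms(3,4)
proof (induction n arbitrary: f g)
  case 0
  then show ?case using bounded_bilinear.continuous_on[OF assms(2)] by auto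
next
  case (Suc n)
  note fS = higher_differentiable_on_SucD[OF Suc.prems(1)]
  note gS = higher_differentiable_on_SucD[OF Suc.prems(2)]
  show ?case
  proof (rule higher_differentiable_on_SucI[OF assms(1)])
    show "((\<lambda>x. B (f x) (g x)) has_derivative
        (\<lambda>v. B (f x) (frechet_derivative g (at x) v) + B (frechet_derivative f (at x) v) (g x))) (at x)"
      if "x \<in> S" for x
      by (rule bounded_bilinear.FDERIV[OF assms(2)])
        (use higher_differentiable_on_has_derivative Suc.prems that in blast)+
    show "higher_differentiable_on S (\<lambda>x. B (f x) (frechet_derivative g (at x) v)
        + B (frechet_derivative f (at x) v) (g x)) n" for v
      using Suc.prems by (intro higher_differentiable_on_add[OF assms(1)] Suc.IH fS gS) auto
  qed
qed

text \<open>Expanding in coordinates turns the composition of linear maps in the chain rule into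
  a sum of products, to which the induction hypotheses apply.\<close>
lemma linear_basis_expansion:
  fixes L :: "'a::euclidean_space \<Rightarrow> 'b::real_vector"
  assumes "linear L"
  shows "L v = (\<Sum>b\<in>Basis. (v \<bullet> b) *\<^sub>R L b)"
proof -
  have "L v = L (\<Sum>b\<in>Basis. (v \<bullet> b) *\<^sub>R b)" by (simp add: euclidean_representation)
  then show ?thesis by (simp add: linear_sum[OF assms] linear_scale[OF assms])
qed

lemma higher_differentiable_on_compose:
  fixes f :: "'b::euclidean_space \<Rightarrow> 'c::real_normed_vector" and g :: "'a::real_normed_vector \<Rightarrow> 'b"
  assumes "open S" "g ` S \<subseteq> T"
    and "higher_differentiable_on T f n" "higher_differentiable_on S g n"
  shows "higher_differentiable_on S (\<lambda>x. f (g x)) n"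
  using assms(3,4)
proof (induction n arbitrary: f)
  case 0
  then show ?case using assms(2) by (auto intro: continuous_on_compose2)
next
  case (Suc n)
  note gS = higher_differentiable_on_SucD[OF Suc.prems(2)]
  show ?case
  proof (rule higher_differentiable_on_SucI[OF assms(1)])
    fix x assume x: "x \<in> S"
    then have gx: "g x \<in> T" using assms(2) by auto
    note f' = higher_differentiable_on_has_derivative[OF Suc.prems(1) gx]
    note g' = higher_differentiable_on_has_derivative[OF Suc.prems(2) x]
    have "((\<lambda>x. f (g x)) has_derivative
        (\<lambda>v. frechet_derivative f (at (g x)) (frechet_derivative g (at x) v))) (at x)"
      using diff_chain_at[OF g' f'] by (simp add: o_def)
    then show "((\<lambda>x. f (g x)) has_derivative
        (\<lambda>v. \<Sum>b\<in>Basis. (frechet_derivative g (at x) v \<bullet> b) *\<^sub>R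
            frechet_derivative f (at (g x)) b)) (at x)"
      by (subst (asm) linear_basis_expansion[OF has_derivative_linear[OF f']])
  next
    fix v
    show "higher_differentiable_on S (\<lambda>x. \<Sum>b\<in>Basis. (frechet_derivative g (at x) v \<bullet> b) *\<^sub>R
            frechet_derivative f (at (g x)) b) n"
    proof (rule higher_differentiable_on_sum[OF assms(1)])
      fix b :: 'b assume "b \<in> Basis"
      have "higher_differentiable_on S (\<lambda>x. frechet_derivative g (at x) v \<bullet> b) n"
        by (rule higher_differentiable_on_linear_compose[OF assms(1) bounded_linear_inner_left])
          (use Suc.prems(2) in auto)
      moreover have "higher_differentiable_on S (\<lambda>x. frechet_derivative f (at (g x)) b) n"
        by (rule Suc.IH[OF _ gS]) (use Suc.prems(1) in auto)
      ultimately show "higher_differentiable_on S (\<lambda>x. (frechet_derivative g (at x) v \<bullet> b) *\<^sub>R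
            frechet_derivative f (at (g x)) b) n"
        by (rule higher_differentiable_on_bilinear[OF assms(1) bounded_bilinear_scaleR])
    qed
  qed
qed

lemma higher_differentiable_on_Pair:
  assumes "open S" "higher_differentiable_on S f n" "higher_differentiable_on S g n"
  shows "higher_differentiable_on S (\<lambda>x. (f x, g x)) n"
proof -
  have "bounded_linear (\<lambda>x. (x, 0))" "bounded_linear (\<lambda>x. (0, x))"
    by (auto intro!: bounded_linear_intros)
  from higher_differentiable_on_add[OF assms(1)
      higher_differentiable_on_linear_compose[OF assms(1) this(1) assms(2)]
      higher_differentiable_on_linear_compose[OF assms(1) this(2) assms(3)]]
  show ?thesis by simp
qed

section \<open>A smooth inverse function theorem and slice charts\<close>

text \<open>The variation of \<open>g\<close> enters the increment of the product multiplied by \<open>f x\<close>, which is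
  \<open>O(norm (x - y))\<close>; continuity of \<open>g\<close> therefore makes its contribution negligible.\<close>
lemma has_derivative_scaleR_vanishing:
  fixes f :: "'a::real_normed_vector \<Rightarrow> real" and g :: "'a \<Rightarrow> 'b::real_normed_vector"
  assumes f: "(f has_derivative f') (at y)" and f0: "f y = 0" and g: "continuous (at y) g"
  shows "((\<lambda>x. f x *\<^sub>R g x) has_derivative (\<lambda>v. f' v *\<^sub>R g y)) (at y)"
proof -
  interpret f': bounded_linear f' using f by (rule has_derivative_bounded_linear)
  obtain K where K: "\<And>v. norm (f' v) \<le> norm v * K" using f'.bounded by blast
  have "((\<lambda>x. (f x - (f y + f' (x - y))) / norm (x - y)) \<longlongrightarrow> 0) (at y)"
    using f unfolding has_derivative_at_within by (simp add: divide_inverse mult.commute algebra_simps)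
  then have l1: "((\<lambda>x. ((f x - (f y + f' (x - y))) / norm (x - y)) *\<^sub>R g x) \<longlongrightarrow> 0 *\<^sub>R g y) (at y)"
    using g unfolding continuous_at by (intro tendsto_scaleR)
  have l2: "((\<lambda>x. (f' (x - y) / norm (x - y)) *\<^sub>R (g x - g y)) \<longlongrightarrow> 0) (at y)"
  proof (rule Lim_null_comparison)
    show "\<forall>\<^sub>F x in at y. norm ((f' (x - y) / norm (x - y)) *\<^sub>R (g x - g y)) \<le> \<bar>K\<bar> * norm (g x - g y)"
    proof (rule always_eventually, rule allI)
      fix x
      have "\<bar>f' (x - y)\<bar> / norm (x - y) \<le> \<bar>K\<bar>"
      proof (cases "x = y")
        case False
        have "\<bar>f' (x - y)\<bar> \<le> norm (x - y) * K" using K by simp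
        also have "\<dots> \<le> norm (x - y) * \<bar>K\<bar>" by (intro mult_left_mono) auto
        finally show ?thesis using False by (simp add: field_simps)
      qed auto
      then show "norm ((f' (x - y) / norm (x - y)) *\<^sub>R (g x - g y)) \<le> \<bar>K\<bar> * norm (g x - g y)"
        by (metis abs_divide abs_norm_cancel mult_right_mono norm_ge_zero norm_scaleR real_norm_def)
    qed
    have "((\<lambda>x. \<bar>K\<bar> * norm (g x - g y)) \<longlongrightarrow> \<bar>K\<bar> * norm (g y - g y)) (at y)"
      using g unfolding continuous_at by (intro tendsto_intros)
    then show "((\<lambda>x. \<bar>K\<bar> * norm (g x - g y)) \<longlongrightarrow> 0) (at y)" by simp
  qed
  have e: "(1 / norm (x - y)) *\<^sub>R (f x *\<^sub>R g x - (f y *\<^sub>R g y + f' (x - y) *\<^sub>R g y)) =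
      ((f x - (f y + f' (x - y))) / norm (x - y)) *\<^sub>R g x + (f' (x - y) / norm (x - y)) *\<^sub>R (g x - g y)" for x
    unfolding f0 by (simp add: algebra_simps divide_inverse scaleR_diff_left)
  have "((\<lambda>x. (1 / norm (x - y)) *\<^sub>R (f x *\<^sub>R g x - (f y *\<^sub>R g y + f' (x - y) *\<^sub>R g y))) \<longlongrightarrow> 0) (at y)"
    unfolding e using tendsto_add[OF l1 l2] by simp
  moreover have "bounded_linear (\<lambda>v. f' v *\<^sub>R g y)"
    using bounded_linear_compose[OF bounded_linear_scaleR_left f'.bounded_linear] .
  ultimately show ?thesis
    unfolding has_derivative_at_within by (simp add: divide_inverse algebra_simps)
qed

text \<open>The inverse function theorem for continuously differentiable maps yields a differentiable
  local inverse \<open>g\<close> with derivative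
  \<open>B y = (A (g y))\<^sup>-\<^sup>1\<close>, where \<open>A x\<close> is the derivative of \<open>f\<close>. Smoothness of \<open>g\<close> is a bootstrap:
  \<open>y \<mapsto> B y v\<close> has a derivative that is a polynomial expression in values of \<open>B\<close> and second
  derivatives of \<open>f\<close> at \<open>g y\<close>, so each order of differentiability of \<open>B\<close> and \<open>g\<close> gives the next.\<close>
theorem smooth_inverse_function_theorem:
  fixes f :: "'a::euclidean_space \<Rightarrow> 'a"
  assumes "open S" "x0 \<in> S" and smooth: "\<And>n. higher_differentiable_on S f n"
    and f0: "(f has_derivative f0) (at x0)" and "inj f0"
  obtains U V g where "open U" "U \<subseteq> S" "x0 \<in> U" "open V" "homeomorphism U V f g"
    "\<And>n. higher_differentiable_on V g n"
proof -
  define A where "A x = frechet_derivative f (at x)" for x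
  have f': "(f has_derivative A x) (at x)" if "x \<in> S" for x
    unfolding A_def using higher_differentiable_on_has_derivative[OF smooth that] .
  have A_smooth: "higher_differentiable_on S (\<lambda>x. A x v) n" for v n
    using smooth[of "Suc n"] by (simp add: A_def)
  define F where "F x = Blinfun (A x)" for x
  have F: "blinfun_apply (F x) = A x" if "x \<in> S" for x
    unfolding F_def by (rule bounded_linear_Blinfun_apply[OF has_derivative_bounded_linear[OF f'[OF that]]])
  have contF: "continuous_on S F"
  proof (rule continuous_on_blinfun_componentwise)
    fix i :: 'a
    show "continuous_on S (\<lambda>x. blinfun_apply (F x) i)"
      using A_smooth[of i 0] by (simp add: F cong: continuous_on_cong)
  qed
  have lin0: "linear f0" using f0 by (rule has_derivative_linear)
  have "A x0 = f0" using has_derivative_unique[OF f'[OF \<open>x0 \<in> S\<close>] f0] .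
  obtain k where k: "linear k" "k \<circ> f0 = id"
    using linear_injective_left_inverse[OF lin0 \<open>inj f0\<close>] by blast
  have "Blinfun k o\<^sub>L F x0 = id_blinfun"
  proof (rule blinfun_eqI)
    fix i
    have "blinfun_apply (Blinfun k) = k"
      using k(1) by (simp add: bounded_linear_Blinfun_apply linear_conv_bounded_linear)
    then show "blinfun_apply (Blinfun k o\<^sub>L F x0) i = blinfun_apply id_blinfun i"
      using k(2) by (simp add: F \<open>x0 \<in> S\<close> \<open>A x0 = f0\<close> fun_eq_iff)
  qed
  then obtain U V g B where UV: "open U" "U \<subseteq> S" "x0 \<in> U" "open V"
    and hom: "homeomorphism U V f g"
    and g': "\<And>y. y \<in> V \<Longrightarrow> (g has_derivative B y) (at y)"
    and B: "\<And>y. y \<in> V \<Longrightarrow> B y = inv (blinfun_apply (F (g y)))"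
    and bij: "\<And>y. y \<in> V \<Longrightarrow> bij (blinfun_apply (F (g y)))"
    using inverse_function_theorem[OF \<open>open S\<close> _ contF \<open>x0 \<in> S\<close>, of f] f' F by metis
  have gV: "g y \<in> U" "g y \<in> S" "f (g y) = y" if "y \<in> V" for y
    using hom that UV(2) by (auto simp: homeomorphism_def)
  have fU: "f x \<in> V" "g (f x) = x" if "x \<in> U" for x
    using hom that by (auto simp: homeomorphism_def)
  have BA: "B y (A (g y) v) = v" "A (g y) (B y v) = v" if "y \<in> V" for y v
    using B[OF that] bij[OF that] F[OF gV(2)[OF that]]
    by (auto simp: bij_def inv_f_f surj_f_inv_f)
  have linB: "linear (B y)" if "y \<in> V" for y
    using has_derivative_linear[OF g'[OF that]] .
  have linA: "linear (A x)" if "x \<in> S" for x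
    using has_derivative_linear[OF f'[OF that]] .

  \<comment> \<open>Invariance of domain for the tangent map \<open>(x, u) \<mapsto> (f x, A x u)\<close>, whose inverse is
    \<open>(y, v) \<mapsto> (g y, B y v)\<close>, gives continuity of \<open>B\<close>.\<close>
  have B_cont: "continuous_on V (\<lambda>y. B y v)" for v
  proof -
    define T where "T p = (f (fst p), A (fst p) (snd p))" for p :: "'a \<times> 'a"
    have T_eq: "T p = (f (fst p), \<Sum>b\<in>Basis. (snd p \<bullet> b) *\<^sub>R A (fst p) b)" if "p \<in> U \<times> UNIV" for p
      using that UV(2) linear_basis_expansion[OF linA, of "fst p" "snd p"] by (auto simp: T_def)
    have "continuous_on (U \<times> UNIV) (\<lambda>p. f (fst p))" "continuous_on (U \<times> UNIV) (\<lambda>p. A (fst p) b)" for b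
      using smooth[of 0] A_smooth[of b 0] UV(2)
      by (auto intro!: continuous_on_compose2[of S _ _ fst] continuous_intros)
    then have "continuous_on (U \<times> UNIV) (\<lambda>p. (f (fst p), \<Sum>b\<in>Basis. (snd p \<bullet> b) *\<^sub>R A (fst p) b))"
      by (intro continuous_intros)
    then have contT: "continuous_on (U \<times> UNIV) T"
      using T_eq by (simp cong: continuous_on_cong)
    have "inj_on T (U \<times> UNIV)"
    proof (rule inj_onI)
      fix p q assume "p \<in> U \<times> UNIV" "q \<in> U \<times> UNIV" and eq: "T p = T q"
      then have pq: "fst p \<in> U" "fst q \<in> U" by auto
      have "fst p = fst q" using eq fU(2) pq unfolding T_def by (metis prod.inject)
      moreover have "snd p = B (f (fst p)) (A (fst p) (snd p))" "snd q = B (f (fst q)) (A (fst q) (snd q))"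
        using BA(1) fU pq by metis+
      ultimately show "p = q" using eq unfolding T_def by (metis prod.inject prod_eqI)
    qed
    then obtain k where k: "homeomorphism (U \<times> UNIV) (T ` (U \<times> UNIV)) T k"
      using invariance_of_domain_homeomorphism[OF _ contT] UV(1) by (auto simp: open_Times)
    have pre: "(y, v) = T (g y, B y v)" "(g y, B y v) \<in> U \<times> UNIV" if "y \<in> V" for y
      using that gV BA by (auto simp: T_def)
    have kT: "k (T p) = p" if "p \<in> U \<times> UNIV" for p
      using k that unfolding homeomorphism_def by blast
    have sub: "(\<lambda>y. (y, v)) ` V \<subseteq> T ` (U \<times> UNIV)"
      using pre by blast
    have eq: "B y v = snd (k (y, v))" if "y \<in> V" for y
      using kT[OF pre(2)[OF that]] pre(1)[OF that] by simp
    have "continuous_on V (\<lambda>y. snd (k (y, v)))"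
      by (intro continuous_on_snd continuous_on_compose2[OF homeomorphism_cont2[OF k] _ sub] continuous_intros)
    then show ?thesis using eq by (simp cong: continuous_on_cong)
  qed

  define A2 where "A2 i j x = frechet_derivative (\<lambda>x. A x j) (at x) i" for i j x
  have A2_smooth: "higher_differentiable_on S (A2 i j) n" for i j n
    using A_smooth[of j "Suc n"] by (simp add: A2_def[abs_def])
  \<comment> \<open>In the notation of linear maps: the derivative of \<open>B y v\<close> in direction \<open>w\<close> is
    \<open>- B y (A' (B y w) (B y v))\<close> with \<open>A'\<close> the derivative of \<open>A\<close> at \<open>g y\<close>.\<close>
  have B': "((\<lambda>y. B y v) has_derivative
      (\<lambda>w. - (\<Sum>k\<in>Basis. ((\<Sum>j\<in>Basis. (B y v \<bullet> j) *\<^sub>R (\<Sum>i\<in>Basis. (B y w \<bullet> i) *\<^sub>R A2 i j (g y))) \<bullet> k)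
          *\<^sub>R B y k))) (at y)" if y: "y \<in> V" for v y
  proof -
    define c where "c z = (\<Sum>j\<in>Basis. (B y v \<bullet> j) *\<^sub>R A (g z) j)" for z
    define c' where "c' w = (\<Sum>j\<in>Basis. (B y v \<bullet> j) *\<^sub>R (\<Sum>i\<in>Basis. (B y w \<bullet> i) *\<^sub>R A2 i j (g y)))" for w
    have Aj: "((\<lambda>z. A (g z) j) has_derivative (\<lambda>w. \<Sum>i\<in>Basis. (B y w \<bullet> i) *\<^sub>R A2 i j (g y))) (at y)" for j
    proof -
      note d = higher_differentiable_on_has_derivative[OF A_smooth[of j] gV(2)[OF y]]
      have "((\<lambda>z. A (g z) j) has_derivative (\<lambda>w. frechet_derivative (\<lambda>x. A x j) (at (g y)) (B y w))) (at y)"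
        using diff_chain_at[OF g'[OF y] d] by (simp add: o_def)
      then show ?thesis unfolding A2_def
        by (subst (asm) linear_basis_expansion[OF has_derivative_linear[OF d]])
    qed
    have "(c has_derivative c') (at y)"
      unfolding c_def[abs_def] c'_def[abs_def]
      by (intro has_derivative_sum has_derivative_scaleR_right Aj)
    then have dk: "((\<lambda>z. (c z - c y) \<bullet> k) has_derivative (\<lambda>w. c' w \<bullet> k)) (at y)" for k
      by (auto intro!: derivative_eq_intros)
    \<comment> \<open>As \<open>c z = A (g z) (B y v)\<close>, the difference \<open>B y v - B z v\<close> equals \<open>B z (c z - c y)\<close>, a product
      of the continuous \<open>B z\<close> and a differentiable factor that vanishes at \<open>y\<close>.\<close>
    have "isCont (\<lambda>z. B z k) y" for k
      using B_cont[of k] UV(4) y by (simp add: continuous_on_eq_continuous_at)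
    then have "((\<lambda>z. B y v - (\<Sum>k\<in>Basis. ((c z - c y) \<bullet> k) *\<^sub>R B z k))
        has_derivative (\<lambda>w. 0 - (\<Sum>k\<in>Basis. (c' w \<bullet> k) *\<^sub>R B y k))) (at y)"
      by (intro has_derivative_diff has_derivative_const has_derivative_sum
          has_derivative_scaleR_vanishing dk) auto
    moreover have "B y v - (\<Sum>k\<in>Basis. ((c z - c y) \<bullet> k) *\<^sub>R B z k) = B z v" if z: "z \<in> V" for z
    proof -
      have c: "c z = A (g z) (B y v)" if "z \<in> V" for z
        unfolding c_def using linear_basis_expansion[OF linA[OF gV(2)[OF that]]] by metis
      have "(\<Sum>k\<in>Basis. ((c z - c y) \<bullet> k) *\<^sub>R B z k) = B z (c z - c y)"
        using linear_basis_expansion[OF linB[OF z]] by metis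
      also have "\<dots> = B y v - B z v"
        using linear_diff[OF linB[OF z]] c[OF z] c[OF y] BA y z by simp
      finally show ?thesis by simp
    qed
    ultimately have "((\<lambda>z. B z v) has_derivative (\<lambda>w. 0 - (\<Sum>k\<in>Basis. (c' w \<bullet> k) *\<^sub>R B y k))) (at y)"
      by (rule has_derivative_transform_within_open[OF _ UV(4) y])
    then show ?thesis by (simp add: c'_def)
  qed

  have B_smooth: "higher_differentiable_on V (\<lambda>y. B y v) n" for v n
  proof (induction n arbitrary: v)
    case 0
    then show ?case using B_cont by simp
  next
    case (Suc n)
    have g: "higher_differentiable_on V g n"
      using higher_differentiable_on_SucI[OF UV(4) g' Suc] by (rule higher_differentiable_on_SucD)
    have A2g: "higher_differentiable_on V (\<lambda>y. A2 i j (g y)) n" for i j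
      by (rule higher_differentiable_on_compose[OF UV(4) _ A2_smooth g]) (use gV in auto)
    note inner = higher_differentiable_on_linear_compose[OF UV(4) bounded_linear_inner_left]
    note scale = higher_differentiable_on_bilinear[OF UV(4) bounded_bilinear_scaleR]
    note sums = higher_differentiable_on_sum[OF UV(4)]
    show ?case
      by (rule higher_differentiable_on_SucI[OF UV(4) B'], assumption)
        (rule higher_differentiable_on_minus[OF UV(4)] sums scale inner Suc A2g)+
  qed
  have "higher_differentiable_on V g n" for n
    using higher_differentiable_on_SucI[OF UV(4) g' B_smooth] by (rule higher_differentiable_on_SucD)
  with UV hom show ?thesis by (intro that)
qed

lemma higher_differentiable_imp_smooth_map_on:
  assumes "open S" "A \<subseteq> S" "\<And>n. higher_differentiable_on S f n"
  shows "smooth_map_on A f"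
  using assms unfolding smooth_map_on_def by blast

text \<open>A submanifold in a manifold can be recognised from a single map of the ambient space that is a
  local diffeomorphism and sends both to linear subspaces.\<close>
lemma flattening_imp_slice_chart:
  fixes \<Phi> :: "'a::euclidean_space \<Rightarrow> 'a"
  assumes "open S" "p \<in> S" "p \<in> N" and smooth: "\<And>n. higher_differentiable_on S \<Phi> n"
    and "(\<Phi> has_derivative \<Phi>') (at p)" "inj \<Phi>'"
    and "subspace L" "M \<subseteq> N" "K \<subseteq> L"
    and N: "\<And>x. x \<in> S \<Longrightarrow> x \<in> N \<longleftrightarrow> \<Phi> x \<in> L" and M: "\<And>x. x \<in> S \<Longrightarrow> x \<in> M \<longleftrightarrow> \<Phi> x \<in> K"
  shows "\<exists>U V \<psi>. p \<in> U \<and> local_chart N L U V \<Phi> \<psi> \<and> \<Phi> ` (M \<inter> U) = V \<inter> K"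
proof -
  obtain U V g where UV: "open U" "U \<subseteq> S" "p \<in> U" "open V" "homeomorphism U V \<Phi> g"
    "\<And>n. higher_differentiable_on V g n"
    using smooth_inverse_function_theorem[OF assms(1,2) smooth assms(5,6)] by blast
  have gV: "g y \<in> U" "\<Phi> (g y) = y" if "y \<in> V" for y
    using UV(5) that by (auto simp: homeomorphism_def)
  have fU: "\<Phi> x \<in> V" "g (\<Phi> x) = x" if "x \<in> U" for x
    using UV(5) that by (auto simp: homeomorphism_def)
  have iN: "x \<in> N \<longleftrightarrow> \<Phi> x \<in> L" "x \<in> M \<longleftrightarrow> \<Phi> x \<in> K" if "x \<in> U" for x
    using N M that UV(2) by auto
  have im: "\<Phi> ` (U \<inter> X) = V \<inter> Y" if "\<And>x. x \<in> U \<Longrightarrow> x \<in> X \<longleftrightarrow> \<Phi> x \<in> Y" for X Y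
  proof (intro equalityI subsetI)
    fix y assume "y \<in> V \<inter> Y"
    then have "y = \<Phi> (g y)" "g y \<in> U \<inter> X" using gV that by auto
    then show "y \<in> \<Phi> ` (U \<inter> X)" by blast
  qed (use fU that in auto)
  have img: "g ` (V \<inter> L) = U \<inter> N"
  proof -
    have "V \<inter> L = \<Phi> ` (U \<inter> N)" using im[OF iN(1)] by simp
    then show ?thesis using fU(2) by (force simp: image_image)
  qed
  have "smooth_map_on (U \<inter> N) \<Phi>"
    by (rule higher_differentiable_imp_smooth_map_on[OF assms(1) _ smooth]) (use UV(2) in auto)
  moreover have "smooth_map_on (V \<inter> L) g"
    by (rule higher_differentiable_imp_smooth_map_on[OF UV(4) _ UV(6)]) auto
  ultimately have "diffeomorphism_between (U \<inter> N) (V \<inter> L) \<Phi> g"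
    unfolding diffeomorphism_between_def using im[OF iN(1)] img gV fU by auto
  moreover have "openin (top_of_set N) (U \<inter> N)" "openin (top_of_set L) (V \<inter> L)"
    using UV by (auto simp: Int_commute intro: openin_open_Int)
  ultimately have "local_chart N L (U \<inter> N) (V \<inter> L) \<Phi> g"
    using assms unfolding local_chart_def by simp
  moreover have "\<Phi> ` (M \<inter> (U \<inter> N)) = (V \<inter> L) \<inter> K"
  proof -
    have "M \<inter> (U \<inter> N) = U \<inter> M" "(V \<inter> L) \<inter> K = V \<inter> K" using \<open>M \<subseteq> N\<close> \<open>K \<subseteq> L\<close> by auto
    then show ?thesis using im[OF iN(2)] by simp
  qed
  ultimately show ?thesis using \<open>p \<in> N\<close> UV(3) by blast
qed

section \<open>Spaces of matrices cut out by orthogonal projectors\<close>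

lemma bounded_bilinear_matrix_mult:
  "bounded_bilinear ((**) :: real^'n^'m \<Rightarrow> real^'p^'n \<Rightarrow> real^'p^'m)"
  unfolding bilinear_conv_bounded_bilinear[symmetric] bilinear_def
  by (auto intro!: linearI simp: matrix_matrix_mult_def vec_eq_iff algebra_simps sum.distrib sum_distrib_left)

interpretation matrix_mult: bounded_bilinear "(**) :: real^'n^'m \<Rightarrow> real^'p^'n \<Rightarrow> real^'p^'m"
  by (rule bounded_bilinear_matrix_mult)

lemma bounded_linear_transpose: "bounded_linear (transpose :: real^'n^'m \<Rightarrow> real^'m^'n)"
  unfolding linear_conv_bounded_linear[symmetric]
  by (auto intro!: linearI simp: transpose_def vec_eq_iff)

lemmas transpose_linear_simps =
  linear_0[OF bounded_linear.linear[OF bounded_linear_transpose]]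
  linear_add[OF bounded_linear.linear[OF bounded_linear_transpose]]
  linear_diff[OF bounded_linear.linear[OF bounded_linear_transpose]]
  linear_scale[OF bounded_linear.linear[OF bounded_linear_transpose]]

definition orthogonal_projector :: "real^'n^'n \<Rightarrow> bool" where
  "orthogonal_projector P \<longleftrightarrow> transpose P = P \<and> P ** P = P"

lemma orthogonal_projector_complement:
  "orthogonal_projector P \<Longrightarrow> orthogonal_projector (mat 1 - P)"
  by (simp add: orthogonal_projector_def transpose_linear_simps matrix_mult.diff_left matrix_mult.diff_right)

lemma orthogonal_projector_mat_1: "orthogonal_projector (mat 1)"
  by (simp add: orthogonal_projector_def)

lemma orthogonal_projector_range_iff:
  assumes "orthogonal_projector P"
  shows "x \<in> range ((*v) P) \<longleftrightarrow> P *v x = x"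
proof
  assume "x \<in> range ((*v) P)"
  then obtain z where "x = P *v z" by auto
  then show "P *v x = x"
    using assms by (simp add: orthogonal_projector_def matrix_vector_mul_assoc)
next
  assume "P *v x = x"
  then show "x \<in> range ((*v) P)" by (rule range_eqI[OF sym])
qed

text \<open>The range of a projector and of its complement are complementary subspaces.\<close>
lemma rank_complement:
  fixes P :: "real^'n^'n"
  assumes "orthogonal_projector P"
  shows "rank P + rank (mat 1 - P) = CARD('n)"
proof -
  let ?S = "range ((*v) P)" and ?T = "range ((*v) (mat 1 - P))"
  have P: "P *v (P *v x) = P *v x" for x
    using assms by (simp add: orthogonal_projector_def matrix_vector_mul_assoc)
  have "x = P *v x + (mat 1 - P) *v x" for x
    by (simp add: matrix_vector_mult_diff_rdistrib)
  then have sum: "{x + y |x y. x \<in> ?S \<and> y \<in> ?T} = UNIV" by blast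
  have int: "?S \<inter> ?T = {0}"
  proof (intro equalityI subsetI)
    fix x assume x: "x \<in> ?S \<inter> ?T"
    then obtain y where "x = P *v y" by auto
    moreover from x obtain z where "x = (mat 1 - P) *v z" by auto
    moreover have "P *v ((mat 1 - P) *v z) = 0" for z
      by (simp add: P matrix_vector_mult_diff_rdistrib matrix_vector_mult_diff_distrib)
    ultimately have "P *v x = x" "P *v x = 0"
      by (simp only: P, metis)
    then show "x \<in> {0}" by simp
  next
    fix x :: "real^'n" assume "x \<in> {0}"
    then show "x \<in> ?S \<inter> ?T" by (auto intro: range_eqI[of _ _ 0])
  qed
  have "subspace ?S" "subspace ?T"
    by (auto intro!: linear_subspace_image)
  from dim_sums_Int[OF this] show ?thesis
    by (simp add: sum int rank_dim_range)
qed

definition outer_product :: "real^'m \<Rightarrow> real^'n \<Rightarrow> real^'n^'m" where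
  "outer_product u v = (\<chi> i j. u $ i * v $ j)"

lemma inner_outer_product:
  "outer_product u v \<bullet> outer_product u' v' = (u \<bullet> u') * (v \<bullet> v')"
  unfolding outer_product_def inner_vec_def sum_product by (simp add: mult_ac)

lemma matrix_mult_outer_product: "A ** outer_product u v = outer_product (A *v u) v"
  by (simp add: outer_product_def matrix_matrix_mult_def matrix_vector_mult_def vec_eq_iff
      sum_distrib_left sum_distrib_right mult_ac)

lemma outer_product_matrix_mult: "outer_product u v ** A = outer_product u (transpose A *v v)"
  by (simp add: outer_product_def matrix_matrix_mult_def matrix_vector_mult_def transpose_def vec_eq_iff
      sum_distrib_left algebra_simps)

lemma outer_product_matrix_vector: "outer_product u v *v x = (v \<bullet> x) *\<^sub>R u"
  by (simp add: outer_product_def matrix_vector_mult_def vec_eq_iff inner_vec_def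
      sum_distrib_left sum_distrib_right algebra_simps)

text \<open>These are the linear maps into the range of \<open>P\<close> that vanish on the kernel of \<open>R\<close>. An orthonormal
  basis is given by the outer products of orthonormal bases of the two ranges.\<close>
lemma dim_matrices_between_projectors:
  fixes P :: "real^'m^'m" and R :: "real^'n^'n"
  assumes P: "orthogonal_projector P" and R: "orthogonal_projector R"
  shows "dim {B :: real^'n^'m. P ** B = B \<and> B ** R = B} = rank P * rank R"
proof -
  let ?H = "{B :: real^'n^'m. P ** B = B \<and> B ** R = B}"
  obtain U where U: "U \<subseteq> range ((*v) P)" "pairwise orthogonal U" "\<And>u. u \<in> U \<Longrightarrow> norm u = 1"
    "independent U" "card U = dim (range ((*v) P))" "span U = range ((*v) P)"
    using orthonormal_basis_subspace[OF linear_subspace_image[OF matrix_vector_mul_linear subspace_UNIV]]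
    by metis
  obtain V where V: "V \<subseteq> range ((*v) R)" "pairwise orthogonal V" "\<And>v. v \<in> V \<Longrightarrow> norm v = 1"
    "independent V" "card V = dim (range ((*v) R))" "span V = range ((*v) R)"
    using orthonormal_basis_subspace[OF linear_subspace_image[OF matrix_vector_mul_linear subspace_UNIV]]
    by metis
  have fin: "finite U" "finite V" using U(4) V(4) by (auto intro: independent_imp_finite)
  have orthU: "u \<bullet> u' = (if u = u' then 1 else 0)" if "u \<in> U" "u' \<in> U" for u u'
    using U(2,3) that by (auto simp: pairwise_def orthogonal_def norm_eq_1)
  have orthV: "v \<bullet> v' = (if v = v' then 1 else 0)" if "v \<in> V" "v' \<in> V" for v v'
    using V(2,3) that by (auto simp: pairwise_def orthogonal_def norm_eq_1)
  define B0 where "B0 = (\<lambda>(u, v). outer_product u v) ` (U \<times> V)"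
  have inj: "inj_on (\<lambda>(u, v). outer_product u v) (U \<times> V)"
  proof (rule inj_onI, clarify)
    fix u v u' v'
    assume uv: "u \<in> U" "v \<in> V" "u' \<in> U" "v' \<in> V" and eq: "outer_product u v = outer_product u' v'"
    have "outer_product u v \<bullet> outer_product u' v' = 1"
      using uv eq inner_outer_product[of u v u v] by (simp add: orthU orthV)
    then show "u = u' \<and> v = v'"
      using uv by (auto simp: inner_outer_product orthU orthV split: if_splits)
  qed
  have ortho: "pairwise orthogonal B0"
    unfolding pairwise_def B0_def by (auto simp: orthogonal_def inner_outer_product orthU orthV)
  have "norm x = 1" if "x \<in> B0" for x
    using that unfolding B0_def by (auto simp: norm_eq_1 inner_outer_product orthU orthV)
  then have "0 \<notin> B0" by force
  then have "independent B0" using pairwise_orthogonal_independent[OF ortho] by blast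
  moreover have "B0 \<subseteq> ?H"
  proof -
    have "P *v u = u" if "u \<in> U" for u
      using U(1) that orthogonal_projector_range_iff[OF P] by blast
    moreover have "transpose R *v v = v" if "v \<in> V" for v
      using V(1) that orthogonal_projector_range_iff[OF R] R
      unfolding orthogonal_projector_def by auto
    ultimately show ?thesis
      unfolding B0_def by (auto simp: matrix_mult_outer_product outer_product_matrix_mult
          simp del: transpose_matrix_vector)
  qed
  moreover have "?H \<subseteq> span B0"
  proof
    fix B assume "B \<in> ?H"
    then have PB: "P ** B = B" and BR: "B ** R = B" by auto
    have "B *v x = (\<Sum>u\<in>U. \<Sum>v\<in>V. (u \<bullet> (B *v v)) *\<^sub>R outer_product u v) *v x" for x
    proof -
      have "P *v (B *v x) = B *v x" using PB by (simp add: matrix_vector_mul_assoc)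
      then have "B *v x \<in> span U" using orthogonal_projector_range_iff[OF P] U(6) by blast
      then have 1: "B *v x = (\<Sum>u\<in>U. ((B *v x) \<bullet> u) *\<^sub>R u)"
        using orthonormal_basis_expand[OF U(2,3)] fin by auto
      have 2: "(B *v x) \<bullet> u = (\<Sum>v\<in>V. (u \<bullet> (B *v v)) * (v \<bullet> x))" for u
      proof -
        let ?w = "transpose B *v u"
        have "R ** transpose B = transpose B"
          using BR R unfolding orthogonal_projector_def by (metis matrix_transpose_mul)
        then have "R *v ?w = ?w" by (metis matrix_vector_mul_assoc)
        then have "?w \<in> span V" using orthogonal_projector_range_iff[OF R] V(6) by blast
        then have w: "?w = (\<Sum>v\<in>V. (?w \<bullet> v) *\<^sub>R v)"
          using orthonormal_basis_expand[OF V(2,3)] fin by auto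
        have wy: "?w \<bullet> y = u \<bullet> (B *v y)" for y by (simp add: dot_lmul_matrix)
        have "(B *v x) \<bullet> u = ?w \<bullet> x" using wy[of x] by (simp only: inner_commute)
        also have "\<dots> = (\<Sum>v\<in>V. (?w \<bullet> v) *\<^sub>R v) \<bullet> x" using w by simp
        finally show ?thesis unfolding wy by (simp add: inner_sum_left)
      qed
      have "(\<Sum>u\<in>U. \<Sum>v\<in>V. (u \<bullet> (B *v v)) *\<^sub>R outer_product u v) *v x
          = (\<Sum>u\<in>U. \<Sum>v\<in>V. ((u \<bullet> (B *v v)) * (v \<bullet> x)) *\<^sub>R u)"
        by (simp add: linear_sum[OF linearI, of "\<lambda>M. M *v x"] matrix_vector_mult_add_rdistrib
            scaleR_matrix_vector_assoc[symmetric] outer_product_matrix_vector)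
      then show ?thesis using 1 unfolding 2 by (simp add: scaleR_sum_left)
    qed
    then have "B = (\<Sum>u\<in>U. \<Sum>v\<in>V. (u \<bullet> (B *v v)) *\<^sub>R outer_product u v)"
      unfolding matrix_eq by blast
    also have "\<dots> \<in> span B0"
      by (intro span_sum span_scale span_base) (auto simp: B0_def)
    finally show "B \<in> span B0" .
  qed
  ultimately have "card B0 = dim ?H" using basis_card_eq_dim by blast
  moreover have "card B0 = rank P * rank R"
    unfolding B0_def using card_image[OF inj] U(5) V(5) by (simp add: card_cartesian_product rank_dim_range)
  ultimately show ?thesis by simp
qed

text \<open>For an orthogonal projector \<open>G\<close> this is the tangent space of the Grassmannian at \<open>G\<close>.\<close>
definition off_diagonal_symmetric :: "real^'n^'n \<Rightarrow> (real^'n^'n) set" where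
  "off_diagonal_symmetric G =
     {A. transpose A = A \<and> G ** A ** G = 0 \<and> (mat 1 - G) ** A ** (mat 1 - G) = 0}"

lemma subspace_off_diagonal_symmetric: "subspace (off_diagonal_symmetric G)"
  unfolding off_diagonal_symmetric_def
  by (rule subspaceI)
    (auto simp: transpose_linear_simps matrix_mult.add_left matrix_mult.add_right
      matrix_mult.scaleR_left matrix_mult.scaleR_right)

text \<open>A symmetric off-diagonal matrix is determined by its lower left block \<open>B = (1 - G) A G\<close>,
  namely \<open>A = B + B\<^sup>T\<close>, and \<open>B\<close> is arbitrary.\<close>
lemma dim_off_diagonal_symmetric:
  assumes G: "orthogonal_projector G"
  shows "dim (off_diagonal_symmetric G) = rank (mat 1 - G) * rank G"
proof -
  define P where "P = mat 1 - G"
  have P: "orthogonal_projector P" unfolding P_def by (rule orthogonal_projector_complement[OF G])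
  have GP: "G ** P = 0" "P ** G = 0" "G + P = mat 1" "G ** G = G" "P ** P = P"
      "transpose G = G" "transpose P = P"
    using G P by (auto simp: P_def orthogonal_projector_def matrix_mult.diff_left matrix_mult.diff_right)
  let ?H = "{B. P ** B = B \<and> B ** G = B}"
  let ?f = "\<lambda>B :: real^'a^'a. B + transpose B"
  have lin: "linear ?f"
    by (auto intro!: linearI simp: transpose_linear_simps algebra_simps)
  have sub: "subspace ?H"
    by (rule subspaceI) (auto simp: matrix_mult.add_left matrix_mult.add_right
      matrix_mult.scaleR_left matrix_mult.scaleR_right)
  have B: "G ** B = 0" "B ** P = 0" "P ** transpose B = 0" "transpose B ** G = 0"
      "G ** transpose B = transpose B" "transpose B ** P = transpose B"
    if "B \<in> ?H" for B
  proof -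
    have PB: "P ** B = B" and BG: "B ** G = B" using that by auto
    have "G ** (P ** B) = 0" "(B ** G) ** P = 0"
      using GP(1) by (simp add: matrix_mul_assoc) (simp add: GP(1) matrix_mul_assoc[symmetric])
    then show 1: "G ** B = 0" and 2: "B ** P = 0" unfolding PB BG .
    show "P ** transpose B = 0" "transpose B ** G = 0"
      using arg_cong[OF 2, of transpose] arg_cong[OF 1, of transpose] GP(6,7)
      by (simp_all add: matrix_transpose_mul transpose_linear_simps)
    show "G ** transpose B = transpose B" "transpose B ** P = transpose B"
      using arg_cong[OF BG, of transpose] arg_cong[OF PB, of transpose] GP(6,7)
      by (simp_all add: matrix_transpose_mul)
  qed
  have "inj_on ?f ?H"
  proof (rule inj_on_inverseI)
    show "P ** ?f B = B" if "B \<in> ?H" for B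
      using that B[OF that] by (simp add: matrix_mult.add_right)
  qed
  then have "dim (?f ` ?H) = dim ?H"
    by (intro dim_image_eq[OF lin]) (simp add: span_eq_iff[THEN iffD2, OF sub])
  moreover have "?f ` ?H = off_diagonal_symmetric G"
  proof (intro equalityI subsetI)
    fix A assume "A \<in> ?f ` ?H"
    then obtain B where H: "B \<in> ?H" "A = ?f B" by blast
    show "A \<in> off_diagonal_symmetric G"
      using H B[OF H(1)] unfolding off_diagonal_symmetric_def P_def[symmetric]
      by (simp add: transpose_linear_simps matrix_mult.add_left matrix_mult.add_right add.commute)
  next
    fix A assume "A \<in> off_diagonal_symmetric G"
    then have A: "transpose A = A" "G ** A ** G = 0" "P ** A ** P = 0"
      by (auto simp: off_diagonal_symmetric_def P_def)
    have "A = (G + P) ** A ** (G + P)" by (simp add: GP(3))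
    also have "\<dots> = P ** A ** G + G ** A ** P"
      using A unfolding matrix_mult.add_left matrix_mult.add_right by simp
    also have "G ** A ** P = transpose (P ** A ** G)"
      using A GP by (simp add: matrix_transpose_mul matrix_mul_assoc)
    finally have "A = ?f (P ** A ** G)" .
    moreover have "P ** A ** G \<in> ?H"
      using GP(4,5) by (simp add: matrix_mul_assoc) (simp add: matrix_mul_assoc[symmetric])
    ultimately show "A \<in> ?f ` ?H" by blast
  qed
  ultimately show ?thesis
    using dim_matrices_between_projectors[OF P G] by (simp add: P_def)
qed

text \<open>The right inverse \<open>E\<close> splits \<open>W\<close> into the kernel of \<open>D\<close> and the range of \<open>E\<close>.\<close>
lemma dim_kernel_right_inverse:
  fixes D :: "'a::euclidean_space \<Rightarrow> 'b::euclidean_space"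
  assumes "linear D" "linear E" "\<And>y. D (E y) = y" "subspace W" "range E \<subseteq> W"
  shows "dim {z \<in> W. D z = 0} + DIM('b) = dim W"
proof -
  let ?K = "{z \<in> W. D z = 0}"
  have "subspace ?K"
    using assms(1,4) by (auto simp: subspace_def linear_0 linear_add linear_scale)
  moreover have "subspace (range E)" by (rule linear_subspace_image[OF assms(2)]) simp
  moreover have "{x + y |x y. x \<in> ?K \<and> y \<in> range E} = W"
  proof (intro equalityI subsetI)
    fix z assume z: "z \<in> W"
    then have "z = (z - E (D z)) + E (D z)" "z - E (D z) \<in> ?K"
      using assms by (auto simp: linear_diff intro!: subspace_diff)
    then show "z \<in> {x + y |x y. x \<in> ?K \<and> y \<in> range E}" by blast
  qed (use assms in \<open>auto intro: subspace_add\<close>)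
  moreover have "?K \<inter> range E = {0}"
    using assms by (auto simp: linear_0 subspace_0) (metis linear_0 rangeI)
  moreover have "dim (range E) = DIM('b)"
    using dim_image_eq[OF assms(2), of UNIV] inj_on_inverseI[of UNIV D E] assms(3) by simp
  ultimately show ?thesis using dim_sums_Int[of ?K "range E"] by simp
qed

section \<open>Flattening the Grassmannian\<close>

lemma Gr_iff: "G \<in> Gr s \<longleftrightarrow> orthogonal_projector G \<and> rank G = s"
  by (auto simp: Gr_def orthogonal_projector_def)

text \<open>For orthogonal projectors \<open>G0\<close> and \<open>G\<close>, a matrix that maps the range of \<open>G0\<close> into the range of \<open>G\<close>
  and the kernel into the kernel, and that is the identity for \<open>G = G0\<close>. Unlike an orthogonal matrix with these
  properties, it is affine in \<open>G\<close>.\<close>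
definition straightening :: "real^'n^'n \<Rightarrow> real^'n^'n \<Rightarrow> real^'n^'n" where
  "straightening G0 G = G ** G0 + (mat 1 - G) ** (mat 1 - G0)"

lemma straightening_self: "orthogonal_projector G \<Longrightarrow> straightening G G = mat 1"
  by (simp add: straightening_def orthogonal_projector_def matrix_mult.diff_left matrix_mult.diff_right)

lemma straightening_intertwines:
  assumes "orthogonal_projector G0" "orthogonal_projector G"
  shows "G ** straightening G0 G = straightening G0 G ** G0"
proof -
  have g: "G ** G = G" "G0 ** G0 = G0" using assms by (auto simp: orthogonal_projector_def)
  then have z: "G ** (mat 1 - G) = 0" "(mat 1 - G0) ** G0 = 0"
    by (simp_all add: matrix_mult.diff_left matrix_mult.diff_right)
  have "G ** straightening G0 G = (G ** G) ** G0 + (G ** (mat 1 - G)) ** (mat 1 - G0)"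
    by (simp only: straightening_def matrix_mult.add_right matrix_mul_assoc)
  moreover have "straightening G0 G ** G0 = G ** (G0 ** G0) + (mat 1 - G) ** ((mat 1 - G0) ** G0)"
    by (simp only: straightening_def matrix_mult.add_left matrix_mul_assoc)
  ultimately show ?thesis by (simp add: g z)
qed

lemma open_invertible_straightening:
  "open {G. invertible (straightening G0 G)}"
proof -
  have "continuous_on UNIV (\<lambda>G. straightening G0 G)"
    unfolding straightening_def by (intro continuous_intros matrix_mult.continuous_on)
  then have "continuous_on UNIV (\<lambda>G. det (straightening G0 G))"
    unfolding det_def by (intro continuous_intros)
  then show ?thesis
    unfolding invertible_det_nz by (intro open_Collect_neq continuous_on_const)
qed

text \<open>The straightening conjugates \<open>G0\<close> to \<open>G\<close>. In particular the rank condition in the definition of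
  the Grassmannian holds automatically near a given point of it.\<close>
lemma rank_eq_of_invertible_straightening:
  assumes "orthogonal_projector G0" "orthogonal_projector G" "invertible (straightening G0 G)"
  shows "rank G = rank G0"
proof -
  let ?T = "straightening G0 G"
  obtain S where S: "?T ** S = mat 1" "S ** ?T = mat 1"
    using assms(3) unfolding invertible_def by blast
  note c = straightening_intertwines[OF assms(1,2)]
  have "G = G ** (?T ** S)" by (simp add: S)
  also have "\<dots> = ?T ** (G0 ** S)" by (simp add: matrix_mul_assoc c)
  finally have "rank G \<le> rank G0" by (metis rank_mul_le_left rank_mul_le_right order_trans)
  have "G0 = (S ** ?T) ** G0" by (simp add: S)
  also have "\<dots> = S ** (G ** ?T)" by (simp add: matrix_mul_assoc[symmetric] c)
  finally have "rank G0 \<le> rank G" by (metis rank_mul_le_left rank_mul_le_right order_trans)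
  with \<open>rank G \<le> rank G0\<close> show ?thesis by simp
qed

text \<open>Let \<open>G\<close> be symmetric, let \<open>M = G\<^sup>2 - G\<close> have vanishing diagonal blocks with respect to \<open>G0\<close>,
  and let \<open>e\<close> be its upper right block. As \<open>M\<close> commutes with \<open>G\<close>, comparing the upper right blocks of \<open>G M\<close> and \<open>M G\<close> gives \<open>a e = e d\<close>, where \<open>a\<close>
  and \<open>d\<close> are the diagonal blocks of \<open>G\<close>. Near \<open>G0\<close>, \<open>a\<close> is close to the identity and \<open>d\<close> to zero, so
  \<open>e = 0\<close>; the other off-diagonal block is the transpose of \<open>e\<close>.\<close>
lemma idempotent_near_projector:
  fixes G0 :: "real^'n^'n"
  assumes G0: "orthogonal_projector G0"
  shows "\<exists>e>0. \<forall>G. norm (G - G0) < e \<longrightarrow> transpose G = G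
      \<longrightarrow> G0 ** (G ** G - G) ** G0 = 0
      \<longrightarrow> (mat 1 - G0) ** (G ** G - G) ** (mat 1 - G0) = 0 \<longrightarrow> G ** G = G"
proof -
  define P where "P = mat 1 - G0"
  have P: "orthogonal_projector P" unfolding P_def by (rule orthogonal_projector_complement[OF G0])
  have GP: "G0 ** P = 0" "P ** G0 = 0" "G0 + P = mat 1" "G0 ** G0 = G0" "P ** P = P"
      "transpose G0 = G0" "transpose P = P"
    using G0 P by (auto simp: P_def orthogonal_projector_def matrix_mult.diff_left matrix_mult.diff_right)
  obtain K where K: "K > 0" "\<And>(A :: real^'n^'n) (B :: real^'n^'n). norm (A ** B) \<le> norm A * norm B * K"
    using matrix_mult.pos_bounded by blast
  have K3: "norm (A ** B ** C) \<le> K * K * norm A * norm B * norm C" for A B C :: "real^'n^'n"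
  proof -
    have "norm (A ** B) * (norm C * K) \<le> (norm A * norm B * K) * (norm C * K)"
      using K by (intro mult_right_mono) simp_all
    then show ?thesis using K(2)[of "A ** B" C] by (simp add: mult_ac)
  qed
  define c where "c = K * K * (norm G0 + norm P) + 1"
  have "c > 0" unfolding c_def using K(1) by (intro add_nonneg_pos mult_nonneg_nonneg) auto
  have "G ** G = G" if near: "norm (G - G0) < 1 / c" and sym: "transpose G = G"
    and 1: "G0 ** (G ** G - G) ** G0 = 0" and 2: "P ** (G ** G - G) ** P = 0" for G
  proof -
    define M where "M = G ** G - G"
    define \<delta> where "\<delta> = G - G0"
    define e where "e = G0 ** M ** P"
    have GM: "G ** M = M ** G"
      by (simp add: M_def matrix_mult.diff_left matrix_mult.diff_right matrix_mul_assoc)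
    have symM: "transpose M = M"
      by (simp add: M_def transpose_linear_simps matrix_transpose_mul sym)
    have te: "transpose e = P ** M ** G0"
      by (simp add: e_def matrix_transpose_mul symM GP matrix_mul_assoc)
    have "M = (G0 + P) ** M ** (G0 + P)" by (simp add: GP(3))
    also have "\<dots> = e + transpose e"
      using 1 2 unfolding te matrix_mult.add_left matrix_mult.add_right by (simp add: e_def M_def)
    finally have M: "M = e + transpose e" .
    have "G0 ** e = e" "G0 ** (P ** M ** G0) = 0"
      by (simp_all only: e_def matrix_mul_assoc GP times0_left)
    then have Ge: "G0 ** e = e" "G0 ** transpose e = 0" unfolding te .
    have "e ** P = e" "P ** M ** G0 ** P = 0" "e ** G0 = 0"
      by (simp_all only: e_def matrix_mul_assoc[symmetric] GP times0_right)
    then have eP: "e ** P = e" "transpose e ** P = 0" "e ** G0 = 0" unfolding te .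
    have "(G0 ** G) ** e = G0 ** (G ** M) ** P"
      using Ge eP by (simp add: M matrix_mult.add_left matrix_mult.add_right matrix_mul_assoc[symmetric])
    also have "\<dots> = e ** (G ** P)"
      using Ge eP by (simp add: GM) (simp add: M matrix_mult.add_left matrix_mult.add_right matrix_mul_assoc)
    finally have "(G0 ** (G0 + \<delta>)) ** e = e ** ((G0 + \<delta>) ** P)" by (simp add: \<delta>_def)
    then have "e = e ** \<delta> ** P - G0 ** \<delta> ** e"
      using Ge eP GP by (simp add: matrix_mult.add_left matrix_mult.add_right matrix_mul_assoc algebra_simps)
    then have "norm e \<le> norm (e ** \<delta> ** P) + norm (G0 ** \<delta> ** e)"
      by (metis norm_triangle_ineq4)
    also have "\<dots> \<le> K * K * norm e * norm \<delta> * norm P + K * K * norm G0 * norm \<delta> * norm e"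
      by (intro add_mono K3)
    finally have "norm e \<le> norm e * (norm \<delta> * (c - 1))"
      by (simp add: c_def algebra_simps)
    also have "\<dots> \<le> norm e * (norm \<delta> * c)" by (simp add: mult_left_mono)
    finally have le: "norm e \<le> norm e * (norm \<delta> * c)" .
    have "norm \<delta> * c < 1" using near \<open>c > 0\<close> by (simp add: \<delta>_def field_simps)
    have "norm e = 0"
    proof (rule ccontr)
      assume "norm e \<noteq> 0"
      then have "norm e * (norm \<delta> * c) < norm e * 1"
        using \<open>norm \<delta> * c < 1\<close> by (intro mult_strict_left_mono) auto
      with le show False by simp
    qed
    then show ?thesis using M by (simp add: M_def transpose_linear_simps)
  qed
  then show ?thesis using \<open>c > 0\<close> unfolding P_def by (intro exI[of _ "1 / c"]) auto
qed

text \<open>In the block form of \<open>G0\<close>: the off-diagonal blocks of \<open>G\<close> together with the diagonal blocks of the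
  defect \<open>G\<^sup>2 - G\<close>. The linear part of the defect at \<open>G0\<close> is the identity on the first diagonal block
  and minus the identity on the second, hence the opposite signs.\<close>
definition block_defect :: "real^'n^'n \<Rightarrow> real^'n^'n \<Rightarrow> real^'n^'n" where
  "block_defect G0 G = (mat 1 - G0) ** G ** G0 + G0 ** G ** (mat 1 - G0)
     + G0 ** (G ** G - G) ** G0 - (mat 1 - G0) ** (G ** G - G) ** (mat 1 - G0)"

text \<open>Taking the symmetric part of the block defect and adding the skew part of \<open>G\<close> itself makes
  symmetry of the value equivalent to symmetry of \<open>G\<close>, so that the target is a linear subspace.\<close>
definition grassmann_flattening :: "real^'n^'n \<Rightarrow> real^'n^'n \<Rightarrow> real^'n^'n" where
  "grassmann_flattening G0 G =
     (1/2) *\<^sub>R (block_defect G0 G + transpose (block_defect G0 G)) + (1/2) *\<^sub>R (G - transpose G)"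

lemma block_defect_blocks:
  assumes "orthogonal_projector G0"
  shows "G0 ** block_defect G0 G ** G0 = G0 ** (G ** G - G) ** G0"
    "(mat 1 - G0) ** block_defect G0 G ** (mat 1 - G0) = - ((mat 1 - G0) ** (G ** G - G) ** (mat 1 - G0))"
proof -
  define P where "P = mat 1 - G0"
  have GP: "G0 ** P = 0" "P ** G0 = 0" "G0 ** G0 = G0" "P ** P = P"
    using assms by (auto simp: P_def orthogonal_projector_def matrix_mult.diff_left matrix_mult.diff_right)
  define M where "M = G ** G - G"
  have X: "G0 ** (A ** B ** C) ** G0 = (G0 ** A) ** B ** (C ** G0)" "P ** (A ** B ** C) ** P = (P ** A) ** B ** (C ** P)"
    for A B C :: "real^'a^'a" by (simp_all add: matrix_mul_assoc)
  show "G0 ** block_defect G0 G ** G0 = G0 ** (G ** G - G) ** G0"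
    "(mat 1 - G0) ** block_defect G0 G ** (mat 1 - G0) = - ((mat 1 - G0) ** (G ** G - G) ** (mat 1 - G0))"
    by (simp_all only: block_defect_def P_def[symmetric] M_def[symmetric] matrix_mult.add_left
        matrix_mult.add_right matrix_mult.diff_left matrix_mult.diff_right X GP times0_left
        times0_right add_0_left add_0_right diff_0_right diff_0)
qed

lemma transpose_block_defect:
  assumes "orthogonal_projector G0"
  shows "transpose (block_defect G0 G) = block_defect G0 (transpose G)"
  using assms unfolding block_defect_def orthogonal_projector_def
  by (simp add: transpose_linear_simps matrix_transpose_mul matrix_mul_assoc)

lemma grassmann_flattening_symmetric_iff:
  "transpose (grassmann_flattening G0 G) = grassmann_flattening G0 G \<longleftrightarrow> transpose G = G"
proof -
  have "(1/2) *\<^sub>R (transpose G - G) = - ((1/2) *\<^sub>R (G - transpose G))"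
    by (simp flip: scaleR_minus_right)
  then have "grassmann_flattening G0 G - transpose (grassmann_flattening G0 G)
      = (1/2) *\<^sub>R (G - transpose G) + (1/2) *\<^sub>R (G - transpose G)"
    by (simp add: grassmann_flattening_def transpose_linear_simps add.commute[of "transpose (block_defect G0 G)"])
  also have "\<dots> = G - transpose G" by (simp flip: scaleR_left_distrib)
  finally have "grassmann_flattening G0 G - transpose (grassmann_flattening G0 G) = G - transpose G" .
  then show ?thesis by (metis eq_iff_diff_eq_0)
qed

lemma grassmann_flattening_of_symmetric:
  assumes "orthogonal_projector G0" "transpose G = G"
  shows "grassmann_flattening G0 G = block_defect G0 G"
  using transpose_block_defect[OF assms(1), of G] assms(2)
  by (simp add: grassmann_flattening_def scaleR_2[symmetric])

text \<open>For symmetric \<open>G\<close> the diagonal blocks of the flattening are those of \<open>\<plusminus>(G\<^sup>2 - G)\<close>, so near \<open>G0\<close>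
  being off-diagonal amounts to idempotency; the neighbourhood also secures the rank.\<close>
lemma grassmann_flattening_iff:
  assumes G0: "orthogonal_projector G0"
  shows "\<exists>S. open S \<and> G0 \<in> S \<and> (\<forall>G\<in>S. invertible (straightening G0 G) \<and>
     (G \<in> Gr (rank G0) \<longleftrightarrow> grassmann_flattening G0 G \<in> off_diagonal_symmetric G0))"
proof -
  obtain e where e: "e > 0" and idem: "\<And>G. norm (G - G0) < e \<Longrightarrow> transpose G = G
      \<Longrightarrow> G0 ** (G ** G - G) ** G0 = 0
      \<Longrightarrow> (mat 1 - G0) ** (G ** G - G) ** (mat 1 - G0) = 0 \<Longrightarrow> G ** G = G"
    using idempotent_near_projector[OF G0] by blast
  let ?S = "ball G0 e \<inter> {G. invertible (straightening G0 G)}"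
  have "open ?S" by (intro open_Int open_ball open_invertible_straightening)
  moreover have "G0 \<in> ?S"
    using e straightening_self[OF G0] by (simp add: invertible_def)
  moreover have "G \<in> Gr (rank G0) \<longleftrightarrow> grassmann_flattening G0 G \<in> off_diagonal_symmetric G0"
    if "G \<in> ?S" for G
  proof -
    have G: "norm (G - G0) < e" "invertible (straightening G0 G)"
      using that by (auto simp: dist_norm norm_minus_commute)
    show ?thesis
    proof (cases "transpose G = G")
      case False
      then show ?thesis
        using grassmann_flattening_symmetric_iff[of G0 G] by (auto simp: Gr_def off_diagonal_symmetric_def)
    next
      case True
      have "grassmann_flattening G0 G \<in> off_diagonal_symmetric G0 \<longleftrightarrow>
          G0 ** (G ** G - G) ** G0 = 0 \<and> (mat 1 - G0) ** (G ** G - G) ** (mat 1 - G0) = 0"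
        using grassmann_flattening_symmetric_iff[of G0 G] True
        unfolding off_diagonal_symmetric_def grassmann_flattening_of_symmetric[OF G0 True]
        by (simp add: block_defect_blocks[OF G0])
      also have "\<dots> \<longleftrightarrow> G ** G = G"
        using idem[OF G(1) True] by auto
      also have "\<dots> \<longleftrightarrow> G \<in> Gr (rank G0)"
        using rank_eq_of_invertible_straightening[OF G0 _ G(2)] True
        by (auto simp: Gr_def orthogonal_projector_def)
      finally show ?thesis by simp
    qed
  qed
  ultimately show ?thesis by blast
qed

lemma grassmann_flattening_has_derivative:
  assumes G0: "orthogonal_projector G0"
  shows "(grassmann_flattening G0 has_derivative (\<lambda>V. V)) (at G0)"
proof -
  define P where "P = mat 1 - G0"
  have GP: "G0 ** P = 0" "P ** G0 = 0" "G0 + P = mat 1" "G0 ** G0 = G0" "P ** P = P"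
    using G0 by (auto simp: P_def orthogonal_projector_def matrix_mult.diff_left matrix_mult.diff_right)
  have lin: "((\<lambda>G. A ** G ** B) has_derivative (\<lambda>V. A ** V ** B)) (at G0)" for A B :: "real^'a^'a"
    by (intro bounded_linear_imp_has_derivative bounded_linear_compose[OF matrix_mult.bounded_linear_left]
        matrix_mult.bounded_linear_right)
  have quad: "((\<lambda>G. A ** (G ** G - G) ** B) has_derivative (\<lambda>V. A ** (G0 ** V + V ** G0 - V) ** B)) (at G0)"
    for A B :: "real^'a^'a"
  proof -
    have "((\<lambda>G. G ** G - G) has_derivative (\<lambda>V. G0 ** V + V ** G0 - V)) (at G0)"
      by (intro has_derivative_diff matrix_mult.FDERIV has_derivative_ident)
    then show ?thesis
      by (rule bounded_linear.has_derivative[OF bounded_linear_compose[OF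
            matrix_mult.bounded_linear_left matrix_mult.bounded_linear_right]])
  qed
  have V: "P ** V ** G0 + G0 ** V ** P + G0 ** (G0 ** V + V ** G0 - V) ** G0
      - P ** (G0 ** V + V ** G0 - V) ** P = V" for V
  proof -
    have a: "A ** (B ** C) ** D = (A ** B) ** C ** D" "A ** (C ** B) ** D = A ** C ** (B ** D)" for A B C D :: "real^'a^'a"
      by (simp_all add: matrix_mul_assoc)
    have "G0 ** (G0 ** V + V ** G0 - V) ** G0 = G0 ** V ** G0"
      unfolding matrix_mult.add_left matrix_mult.add_right matrix_mult.diff_left matrix_mult.diff_right
        a(1)[of G0 G0] a(2)[of G0 V G0] GP by simp
    moreover have "P ** (G0 ** V + V ** G0 - V) ** P = - (P ** V ** P)"
      unfolding matrix_mult.add_left matrix_mult.add_right matrix_mult.diff_left matrix_mult.diff_right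
        a(1)[of P G0] a(2)[of P V G0] GP by simp
    moreover have "V = (G0 + P) ** V ** (G0 + P)" by (simp add: GP(3))
    ultimately show ?thesis
      unfolding matrix_mult.add_left matrix_mult.add_right by (simp add: algebra_simps)
  qed
  have "(block_defect G0 has_derivative (\<lambda>V. P ** V ** G0 + G0 ** V ** P
      + G0 ** (G0 ** V + V ** G0 - V) ** G0 - P ** (G0 ** V + V ** G0 - V) ** P)) (at G0)"
    unfolding block_defect_def[abs_def] P_def[symmetric]
    by (intro has_derivative_diff has_derivative_add lin quad)
  then have d: "(block_defect G0 has_derivative (\<lambda>V. V)) (at G0)" unfolding V .
  have "(grassmann_flattening G0 has_derivative
      (\<lambda>V. (1/2) *\<^sub>R (V + transpose V) + (1/2) *\<^sub>R (V - transpose V))) (at G0)"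
    unfolding grassmann_flattening_def[abs_def]
    by (intro has_derivative_add has_derivative_diff has_derivative_scaleR_right d has_derivative_ident
        bounded_linear.has_derivative[OF bounded_linear_transpose])
  moreover have "(1/2) *\<^sub>R (V + transpose V) + (1/2) *\<^sub>R (V - transpose V) = V" for V :: "real^'a^'a"
    by (simp add: algebra_simps scaleR_2[symmetric])
  ultimately show ?thesis by simp
qed

lemmas higher_differentiable_on_matrix_mult =
  higher_differentiable_on_bilinear[OF _ bounded_bilinear_matrix_mult]

lemma higher_differentiable_on_grassmann_flattening:
  "higher_differentiable_on UNIV (grassmann_flattening G0) n"
proof -
  have bd: "higher_differentiable_on UNIV (block_defect G0) n"
    unfolding block_defect_def[abs_def]
    by (intro higher_differentiable_on_add higher_differentiable_on_diff
        higher_differentiable_on_matrix_mult open_UNIV higher_differentiable_on_const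
        higher_differentiable_on_linear[OF open_UNIV bounded_linear_ident])
  note tr = higher_differentiable_on_linear_compose[OF open_UNIV bounded_linear_transpose]
  note sc = higher_differentiable_on_linear_compose[OF open_UNIV bounded_linear_scaleR_right]
  show ?thesis
    unfolding grassmann_flattening_def[abs_def]
    by (intro sc higher_differentiable_on_add higher_differentiable_on_diff tr bd open_UNIV
        higher_differentiable_on_linear[OF open_UNIV bounded_linear_ident])
qed

section \<open>Simultaneous slice charts\<close>

text \<open>The term \<open>- P Y + \<rho> X\<close> exchanges the linear part \<open>P Y\<close> of the coordinate \<open>Y\<close> for the nonlinear
  \<open>\<rho> X\<close>; it is used with \<open>P\<close> the derivative of \<open>\<rho>\<close>, so that to first order only the straightening
  is felt.\<close>
definition simultaneous_flattening ::
  "real^'n^'n \<Rightarrow> (real^'n^'m \<Rightarrow> real^'n^'m) \<Rightarrow> (real^'n^'m \<Rightarrow> real^'n^'m) \<Rightarrow>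
    (real^'n^'m) \<times> (real^'n^'n) \<Rightarrow> (real^'n^'m) \<times> (real^'n^'n)" where
  "simultaneous_flattening G0 P \<rho> = (\<lambda>(X, G).
     (let Y = X ** straightening G0 G in (Y - P Y + \<rho> X, grassmann_flattening G0 G)))"

lemma simultaneous_flattening_smooth:
  assumes "linear P" "\<And>n. higher_differentiable_on UNIV \<rho> n"
  shows "higher_differentiable_on UNIV (simultaneous_flattening G0 P \<rho>) n"
proof -
  note id = higher_differentiable_on_linear[OF open_UNIV]
  note cmp = higher_differentiable_on_compose[OF open_UNIV subset_UNIV]
  have P: "bounded_linear P" using assms(1) by (simp add: linear_conv_bounded_linear)
  have T: "higher_differentiable_on UNIV (\<lambda>p. straightening G0 (snd p)) n"
    unfolding straightening_def
    by (intro higher_differentiable_on_add higher_differentiable_on_diff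
        higher_differentiable_on_matrix_mult open_UNIV higher_differentiable_on_const
        id bounded_linear_snd)
  have Y: "higher_differentiable_on UNIV (\<lambda>p. fst p ** straightening G0 (snd p)) n"
    by (intro higher_differentiable_on_matrix_mult open_UNIV id bounded_linear_fst T)
  have PY: "higher_differentiable_on UNIV (\<lambda>p. P (fst p ** straightening G0 (snd p))) n"
    by (rule higher_differentiable_on_linear_compose[OF open_UNIV P Y])
  have R: "higher_differentiable_on UNIV (\<lambda>p. \<rho> (fst p)) n"
    by (rule cmp[OF assms(2) id[OF bounded_linear_fst]])
  have F: "higher_differentiable_on UNIV (\<lambda>p. grassmann_flattening G0 (snd p)) n"
    by (rule cmp[OF higher_differentiable_on_grassmann_flattening id[OF bounded_linear_snd]])
  have "simultaneous_flattening G0 P \<rho> = (\<lambda>p. (fst p ** straightening G0 (snd p)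
      - P (fst p ** straightening G0 (snd p)) + \<rho> (fst p), grassmann_flattening G0 (snd p)))"
    by (auto simp: simultaneous_flattening_def fun_eq_iff Let_def)
  then show ?thesis
    using higher_differentiable_on_Pair[OF open_UNIV higher_differentiable_on_add[OF open_UNIV
          higher_differentiable_on_diff[OF open_UNIV Y PY] R] F] by simp
qed

text \<open>At \<open>(X0, G0)\<close> the derivative is triangular with identities on the diagonal: \<open>- P\<close> from the
  coordinate \<open>Y\<close> cancels the derivative of \<open>\<rho>\<close>.\<close>
lemma simultaneous_flattening_has_derivative:
  assumes G0: "orthogonal_projector G0" and "(\<rho> has_derivative P) (at X0)"
  shows "(simultaneous_flattening G0 P \<rho> has_derivative
     (\<lambda>(V, W). let R = X0 ** (W ** G0 - W ** (mat 1 - G0)) in (V + R - P R, W))) (at (X0, G0))"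
proof -
  have P: "bounded_linear P" using assms(2) by (rule has_derivative_bounded_linear)
  then have linP: "linear P" by (rule bounded_linear.linear)
  have T: "((\<lambda>p. straightening G0 (snd p)) has_derivative
      (\<lambda>w. snd w ** G0 + (0 - snd w) ** (mat 1 - G0))) (at (X0, G0))"
    unfolding straightening_def
    by (intro has_derivative_add has_derivative_diff has_derivative_const has_derivative_snd has_derivative_ident
        bounded_linear.has_derivative[OF matrix_mult.bounded_linear_left])
  have "((\<lambda>p. fst p ** straightening G0 (snd p)) has_derivative
      (\<lambda>w. fst (X0, G0) ** (snd w ** G0 + (0 - snd w) ** (mat 1 - G0))
        + fst w ** straightening G0 (snd (X0, G0)))) (at (X0, G0))"
    by (rule matrix_mult.FDERIV[OF has_derivative_fst[OF has_derivative_ident] T])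
  then have Y: "((\<lambda>p. fst p ** straightening G0 (snd p)) has_derivative
      (\<lambda>w. X0 ** (snd w ** G0 - snd w ** (mat 1 - G0)) + fst w)) (at (X0, G0))"
    by (simp add: straightening_self[OF G0] matrix_mult.minus_left)
  have R: "((\<lambda>p. \<rho> (fst p)) has_derivative (\<lambda>w. P (fst w))) (at (X0, G0))"
    using diff_chain_at[OF has_derivative_fst[OF has_derivative_ident], of \<rho> P "(X0, G0)"] assms(2)
    by (simp add: o_def)
  have F: "((\<lambda>p. grassmann_flattening G0 (snd p)) has_derivative (\<lambda>w. snd w)) (at (X0, G0))"
    using diff_chain_at[OF has_derivative_snd[OF has_derivative_ident], of "grassmann_flattening G0" "\<lambda>V. V" "(X0, G0)"]
      grassmann_flattening_has_derivative[OF G0] by (simp add: o_def)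
  have "simultaneous_flattening G0 P \<rho> = (\<lambda>p. (fst p ** straightening G0 (snd p)
      - P (fst p ** straightening G0 (snd p)) + \<rho> (fst p), grassmann_flattening G0 (snd p)))"
    by (auto simp: simultaneous_flattening_def fun_eq_iff Let_def)
  moreover have "(\<lambda>(V, W). let R = X0 ** (W ** G0 - W ** (mat 1 - G0)) in (V + R - P R, W)) =
      (\<lambda>w. (X0 ** (snd w ** G0 - snd w ** (mat 1 - G0)) + fst w
        - P (X0 ** (snd w ** G0 - snd w ** (mat 1 - G0)) + fst w) + P (fst w), snd w))"
    by (auto simp: fun_eq_iff Let_def linear_add[OF linP])
  ultimately show ?thesis
    using has_derivative_Pair[OF has_derivative_add[OF has_derivative_diff[OF Y
          bounded_linear.has_derivative[OF P Y]] R] F] by simp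
qed

text \<open>The constraint is presented as \<open>\<rho> X = 0\<close> with values in the matrix space itself, such that the
  derivative \<open>P\<close> of \<open>\<rho>\<close> at \<open>X0\<close> is a projection whose range contains the values of \<open>\<rho>\<close> and consists
  of matrices annihilated by \<open>G0\<close>. Then \<open>P Z = \<rho> X\<close> and \<open>Z G0 = Y G0\<close> for the new coordinate \<open>Z\<close>,
  so both equations become linear in \<open>Z\<close>. With \<open>\<rho> = 0\<close> the statement provides the charts of the
  ambient manifold.\<close>
lemma simultaneous_slice_chart:
  fixes G0 :: "real^'n^'n" and \<rho> :: "real^'n^'m \<Rightarrow> real^'n^'m"
  assumes G0: "orthogonal_projector G0"
    and smooth: "\<And>n. higher_differentiable_on UNIV \<rho> n"
    and deriv: "(\<rho> has_derivative P) (at X0)"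
    and PP: "\<And>Z. P (P Z) = P Z" and P\<rho>: "\<And>X. P (\<rho> X) = \<rho> X" and PG: "\<And>Z. P Z ** G0 = 0"
  defines "N \<equiv> UNIV \<times> Gr (rank G0)"
    and "M \<equiv> {(X, G). G \<in> Gr (rank G0) \<and> X ** G = 0 \<and> \<rho> X = 0}"
  shows "\<exists>U V \<phi> \<psi>. (X0, G0) \<in> U \<and> local_chart N (UNIV \<times> off_diagonal_symmetric G0) U V \<phi> \<psi> \<and>
    \<phi> ` (M \<inter> U) = V \<inter> ({Z. Z ** G0 = 0 \<and> P Z = 0} \<times> off_diagonal_symmetric G0)"
proof -
  have linP: "linear P" using deriv by (rule has_derivative_linear)
  obtain S where S: "open S" "G0 \<in> S" "\<And>G. G \<in> S \<Longrightarrow> invertible (straightening G0 G)"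
    "\<And>G. G \<in> S \<Longrightarrow> G \<in> Gr (rank G0) \<longleftrightarrow> grassmann_flattening G0 G \<in> off_diagonal_symmetric G0"
    using grassmann_flattening_iff[OF G0] by blast
  let ?\<Phi> = "simultaneous_flattening G0 P \<rho>"
  let ?\<Phi>' = "\<lambda>(V, W). let R = X0 ** (W ** G0 - W ** (mat 1 - G0)) in (V + R - P R, W)"
  have "inj ?\<Phi>'" by (auto simp: inj_def Let_def)
  have slice: "(X, G) \<in> M \<longleftrightarrow> ?\<Phi> (X, G) \<in> {Z. Z ** G0 = 0 \<and> P Z = 0} \<times> off_diagonal_symmetric G0"
    if "G \<in> S" for X G
  proof (cases "G \<in> Gr (rank G0)")
    case False
    then show ?thesis using S(4)[OF that] by (simp add: M_def simultaneous_flattening_def Let_def)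
  next
    case True
    define Y where "Y = X ** straightening G0 G"
    define Z where "Z = Y - P Y + \<rho> X"
    have "P Z = \<rho> X"
      by (simp add: Z_def linear_add[OF linP] linear_diff[OF linP] PP P\<rho>)
    moreover have "\<rho> X ** G0 = 0" using PG[of "\<rho> X"] by (simp add: P\<rho>)
    then have "Z ** G0 = Y ** G0"
      by (simp add: Z_def matrix_mult.add_left matrix_mult.diff_left PG)
    moreover have "Y ** G0 = (X ** G) ** straightening G0 G"
      using straightening_intertwines[OF G0, of G] True
      by (simp add: Y_def Gr_iff matrix_mul_assoc[symmetric])
    moreover have "(X ** G) ** straightening G0 G = 0 \<longleftrightarrow> X ** G = 0"
      using S(3)[OF that] unfolding invertible_def
      by (metis matrix_mul_assoc matrix_mul_rid times0_left)
    moreover have "?\<Phi> (X, G) = (Z, grassmann_flattening G0 G)"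
      by (simp add: simultaneous_flattening_def Let_def Z_def Y_def)
    ultimately show ?thesis using S(4)[OF that] True by (auto simp: M_def)
  qed
  have "\<exists>U V \<psi>. (X0, G0) \<in> U \<and> local_chart N (UNIV \<times> off_diagonal_symmetric G0) U V ?\<Phi> \<psi> \<and>
    ?\<Phi> ` (M \<inter> U) = V \<inter> ({Z. Z ** G0 = 0 \<and> P Z = 0} \<times> off_diagonal_symmetric G0)"
  proof (rule flattening_imp_slice_chart)
    show "open (UNIV \<times> S)" using S(1) by (simp add: open_Times)
    show "(X0, G0) \<in> UNIV \<times> S" using S(2) by simp
    show "(X0, G0) \<in> N" using G0 by (simp add: N_def Gr_iff)
    show "higher_differentiable_on (UNIV \<times> S) ?\<Phi> n" for n
      by (rule higher_differentiable_on_subset[OF simultaneous_flattening_smooth[OF linP smooth]]) simp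
    show "(?\<Phi> has_derivative ?\<Phi>') (at (X0, G0))"
      by (rule simultaneous_flattening_has_derivative[OF G0 deriv])
    show "subspace (UNIV \<times> off_diagonal_symmetric G0)"
      by (intro subspace_Times subspace_UNIV subspace_off_diagonal_symmetric)
    show "p \<in> N \<longleftrightarrow> ?\<Phi> p \<in> UNIV \<times> off_diagonal_symmetric G0" if "p \<in> UNIV \<times> S" for p
      using that S(4) by (auto simp: N_def simultaneous_flattening_def Let_def)
    show "p \<in> M \<longleftrightarrow> ?\<Phi> p \<in> {Z. Z ** G0 = 0 \<and> P Z = 0} \<times> off_diagonal_symmetric G0"
      if "p \<in> UNIV \<times> S" for p
      using that slice[of "snd p" "fst p"] by (cases p) auto
  qed (use \<open>inj ?\<Phi>'\<close> in \<open>auto simp: M_def N_def\<close>)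
  then show ?thesis by blast
qed

lemma smooth_manifold_times_Gr:
  fixes s :: nat
  assumes "s \<le> CARD('n)"
  shows "smooth_manifold ((UNIV :: (real^'n^'m) set) \<times> (Gr s :: (real^'n^'n) set))
    (CARD('m) * CARD('n) + (CARD('n) - s) * s)"
  unfolding smooth_manifold_def
proof
  fix p assume p: "p \<in> (UNIV :: (real^'n^'m) set) \<times> (Gr s :: (real^'n^'n) set)"
  obtain X0 G0 where p0: "p = (X0, G0)" by (cases p)
  have G0: "orthogonal_projector G0" "rank G0 = s" using p p0 by (auto simp: Gr_iff)
  have rank_compl: "rank (mat 1 - G0) = CARD('n) - s"
    using rank_complement[OF G0(1)] G0(2) by simp
  have "\<exists>U V \<phi> \<psi>. (X0, G0) \<in> U \<and>
      local_chart ((UNIV :: (real^'n^'m) set) \<times> Gr (rank G0)) (UNIV \<times> off_diagonal_symmetric G0) U V \<phi> \<psi>"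
    using simultaneous_slice_chart[OF G0(1) higher_differentiable_on_const[OF open_UNIV, of 0]
        has_derivative_const, of X0] by simp blast
  then obtain U V \<phi> \<psi> where "p \<in> U"
    "local_chart ((UNIV :: (real^'n^'m) set) \<times> Gr s) (UNIV \<times> off_diagonal_symmetric G0) U V \<phi> \<psi>"
    unfolding p0 G0(2) by blast
  moreover have "dim ((UNIV :: (real^'n^'m) set) \<times> off_diagonal_symmetric G0)
      = CARD('m) * CARD('n) + (CARD('n) - s) * s"
    using rank_compl G0(2)
    by (simp add: dim_Times subspace_off_diagonal_symmetric dim_off_diagonal_symmetric[OF G0(1)])
  ultimately show "\<exists>L U V \<phi> \<psi>. dim L = CARD('m) * CARD('n) + (CARD('n) - s) * s \<and> p \<in> U \<and>
      local_chart (UNIV \<times> Gr s) L U V \<phi> \<psi>" by blast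
qed

section \<open>The constraint defined by an orthogonally invariant map\<close>

lemma dim_matrices_annihilating:
  fixes G :: "real^'n^'n"
  assumes "orthogonal_projector G"
  shows "dim {Z :: real^'n^'m. Z ** G = 0} = CARD('m) * (CARD('n) - rank G)"
proof -
  have "{Z :: real^'n^'m. Z ** G = 0} = {Z. mat 1 ** Z = Z \<and> Z ** (mat 1 - G) = Z}"
    by (auto simp: matrix_mult.diff_right)
  then show ?thesis
    using dim_matrices_between_projectors[OF orthogonal_projector_mat_1 orthogonal_projector_complement[OF assms],
        where ?'m = 'm] rank_complement[OF assms]
    by (simp add: rank_I)
qed

text \<open>The reflection \<open>Q = 1 - 2 G\<close> is orthogonal, fixes \<open>X\<close> and sends \<open>V G\<close> to \<open>- V G\<close>. Differentiating
  \<open>h (Z Q) = h Z\<close> at \<open>X\<close> gives \<open>D (V G) = - D (V G)\<close>.\<close>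
lemma orthogonally_invariant_derivative:
  fixes h :: "real^'n^'m \<Rightarrow> real^'q"
  assumes "orthogonally_invariant h" "orthogonal_projector G" "X ** G = 0"
    and h': "(h has_derivative D) (at X)"
  shows "D (V ** G) = 0"
proof -
  define Q where "Q = mat 1 - G - G"
  have g: "G ** G = G" "transpose G = G" using assms(2) by (auto simp: orthogonal_projector_def)
  have tQ: "transpose Q = Q" unfolding Q_def transpose_linear_simps g by simp
  have "Q ** Q = mat 1"
    unfolding Q_def matrix_mult.diff_left matrix_mult.diff_right g matrix_mul_lid matrix_mul_rid by simp
  then have "orthogonal_matrix Q" by (simp add: orthogonal_matrix tQ)
  then have inv: "h (Z ** Q) = h Z" for Z
    using assms(1) by (auto simp: orthogonally_invariant_def)
  have XQ: "X ** Q = X"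
    unfolding Q_def matrix_mult.diff_right assms(3) by simp
  have lin: "linear D" using h' by (rule has_derivative_linear)
  have "((\<lambda>Z. Z ** Q) has_derivative (\<lambda>W. W ** Q)) (at X)"
    by (rule bounded_linear_imp_has_derivative[OF matrix_mult.bounded_linear_left])
  from diff_chain_at[OF this, of h D] have "((\<lambda>Z. h (Z ** Q)) has_derivative (\<lambda>W. D (W ** Q))) (at X)"
    using h' by (simp add: XQ o_def)
  then have "(h has_derivative (\<lambda>W. D (W ** Q))) (at X)" by (simp add: inv)
  from has_derivative_unique[OF this h'] have "D (W ** Q) = D W" for W by metis
  moreover have "(V ** G) ** Q = - (V ** G)"
    unfolding Q_def matrix_mult.diff_right matrix_mul_rid matrix_mul_assoc[symmetric] g by simp
  ultimately have "D (V ** G) = - D (V ** G)" by (metis linear_neg[OF lin])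
  then have "2 *\<^sub>R D (V ** G) = 0" by (metis add.right_inverse scaleR_2)
  then show ?thesis by simp
qed

theorem theorem2:
  fixes h :: "real^'n^'m \<Rightarrow> real^'q"
    and r :: nat
  assumes "r \<le> min CARD('m) CARD('n)"
    and "smooth_map_on UNIV h"
    and "orthogonally_invariant h"
    and "\<And>X. h X = 0 \<Longrightarrow> dim (range (frechet_derivative h (at X))) = CARD('q)"
  shows "embedded_submanifold_in (UNIV \<times> Gr (CARD('n) - r)) (M_set h r)
           ((int CARD('m) + int CARD('n) - int r) * int r - int CARD('q))"
proof -
  let ?s = "CARD('n) - r"
  let ?k = "CARD('m) * CARD('n) + (CARD('n) - ?s) * ?s"
  have rn: "r \<le> CARD('n)" "CARD('n) - ?s = r" using assms(1) by auto
  have h_smooth: "higher_differentiable_on UNIV h n" for n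
  proof (rule higher_differentiable_on_locally)
    fix X :: "real^'n^'m"
    obtain U g where U: "open U" "X \<in> U" "\<And>n. higher_differentiable_on U g n" "\<And>Y. Y \<in> U \<Longrightarrow> h Y = g Y"
      using assms(2) unfolding smooth_map_on_def by auto metis
    then have "higher_differentiable_on U h n"
      using higher_differentiable_on_cong[OF U(1) _ U(3)] by metis
    with U show "\<exists>U. open U \<and> X \<in> U \<and> higher_differentiable_on U h n" by blast
  qed
  have chart: "\<exists>L K U V \<phi> \<psi>. dim L = ?k \<and> p \<in> U \<and> local_chart (UNIV \<times> Gr ?s) L U V \<phi> \<psi> \<and>
      subspace K \<and> K \<subseteq> L \<and> int (dim K) = (int CARD('m) + int CARD('n) - int r) * int r - int CARD('q) \<and>
      \<phi> ` (M_set h r \<inter> U) = V \<inter> K" if p: "p \<in> M_set h r" for p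
  proof -
    obtain X0 G0 where p0: "p = (X0, G0)" by (cases p)
    have G0: "orthogonal_projector G0" "rank G0 = ?s" and X0: "X0 ** G0 = 0" "h X0 = 0"
      using p p0 by (auto simp: Gr_iff M_set_def)
    define D where "D = frechet_derivative h (at X0)"
    have h': "(h has_derivative D) (at X0)"
      unfolding D_def by (rule higher_differentiable_on_has_derivative[OF h_smooth UNIV_I])
    then have linD: "linear D" by (rule has_derivative_linear)
    have "surj D"
      using assms(4)[OF X0(2)] linear_subspace_image[OF linD subspace_UNIV]
        subspace_dim_equal[of "range D" UNIV] by (simp add: D_def)
    then obtain E0 where E0: "linear E0" "D \<circ> E0 = id"
      using linear_surjective_right_inverse[OF linD] by blast
    \<comment> \<open>Truncating to matrices annihilated by \<open>G0\<close> keeps \<open>E\<close> a right inverse, as \<open>D\<close> ignores the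
      discarded part.\<close>
    define E where "E y = E0 y ** (mat 1 - G0)" for y
    have "bounded_linear E"
      unfolding E_def using E0(1) matrix_mult.bounded_linear_left
      by (intro bounded_linear_compose[OF matrix_mult.bounded_linear_left]) (simp add: linear_conv_bounded_linear)
    then have linE: "linear E" by (rule bounded_linear.linear)
    have DE: "D (E y) = y" for y
    proof -
      have "E y = E0 y - E0 y ** G0" by (simp add: E_def matrix_mult.diff_right)
      then have "D (E y) = D (E0 y)"
        using orthogonally_invariant_derivative[OF assms(3) G0(1) X0(1) h', of "E0 y"]
        by (simp add: linear_diff[OF linD])
      then show ?thesis using E0(2) by (simp add: fun_eq_iff)
    qed
    have EG: "E y ** G0 = 0" for y
      using G0(1) by (simp add: E_def orthogonal_projector_def matrix_mul_assoc[symmetric] matrix_mult.diff_left)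
    have E_eq_0: "E y = 0 \<longleftrightarrow> y = 0" for y
      using DE linear_0[OF linD] linear_0[OF linE] by metis
    have rank_compl: "rank (mat 1 - G0) = r"
      using rank_complement[OF G0(1)] G0(2) rn by simp
    let ?W = "{Z :: real^'n^'m. Z ** G0 = 0}"
    let ?K1 = "{Z :: real^'n^'m. Z ** G0 = 0 \<and> E (D Z) = 0}"
    let ?L0 = "off_diagonal_symmetric G0"
    have "((\<lambda>X. E (h X)) has_derivative (\<lambda>V. E (D V))) (at X0)"
      by (rule bounded_linear.has_derivative[OF \<open>bounded_linear E\<close> h'])
    from simultaneous_slice_chart[OF G0(1) _ this]
    obtain U V \<phi> \<psi> where "p \<in> U" "local_chart (UNIV \<times> Gr ?s) (UNIV \<times> ?L0) U V \<phi> \<psi>"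
      "\<phi> ` (M_set h r \<inter> U) = V \<inter> (?K1 \<times> ?L0)"
      using higher_differentiable_on_linear_compose[OF open_UNIV \<open>bounded_linear E\<close> h_smooth]
      by (auto simp: DE EG E_eq_0 G0(2) p0 M_set_def)
    moreover have sub1: "subspace ?K1"
      by (rule subspaceI) (auto simp: matrix_mult.add_left matrix_mult.scaleR_left linear_0[OF linD] linear_0[OF linE]
          linear_add[OF linD] linear_add[OF linE] linear_scale[OF linD] linear_scale[OF linE])
    have subW: "subspace ?W"
      by (rule subspaceI) (auto simp: matrix_mult.add_left matrix_mult.scaleR_left)
    have "subspace (?K1 \<times> ?L0)"
      by (intro subspace_Times sub1 subspace_off_diagonal_symmetric)
    moreover have "int (dim (?K1 \<times> ?L0)) = (int CARD('m) + int CARD('n) - int r) * int r - int CARD('q)"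
    proof -
      have "?K1 = {Z \<in> ?W. D Z = 0}" by (simp add: E_eq_0)
      then have "dim ?K1 + CARD('q) = CARD('m) * r"
        using dim_kernel_right_inverse[OF linD linE DE subW] EG rn
          dim_matrices_annihilating[OF G0(1), where ?'m = 'm] by (auto simp: G0(2))
      moreover have "dim ?L0 = r * (CARD('n) - r)"
        using dim_off_diagonal_symmetric[OF G0(1)] rank_compl G0(2) by simp
      ultimately have "dim (?K1 \<times> ?L0) + CARD('q) = CARD('m) * r + r * (CARD('n) - r)"
        by (simp only: dim_Times[OF sub1 subspace_off_diagonal_symmetric])
      from arg_cong[OF this, of int] have "int (dim (?K1 \<times> ?L0)) + int CARD('q)
          = int CARD('m) * int r + int r * (int CARD('n) - int r)"
        unfolding of_nat_add of_nat_mult of_nat_diff[OF rn(1)] .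
      then show ?thesis by (simp add: algebra_simps)
    qed
    moreover have "dim ((UNIV :: (real^'n^'m) set) \<times> ?L0) = ?k"
      using dim_off_diagonal_symmetric[OF G0(1)] rank_compl G0(2) rn
      by (simp add: dim_Times subspace_off_diagonal_symmetric)
    ultimately show ?thesis by blast
  qed
  have "M_set h r \<subseteq> UNIV \<times> Gr ?s" by (auto simp: M_set_def)
  then show ?thesis
    unfolding embedded_submanifold_in_def
    using smooth_manifold_times_Gr[of ?s, where ?'n = 'n and ?'m = 'm] chart by (intro conjI exI[of _ ?k]) auto
qed

end
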